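(* Let $t$ be a positive integer and $0\le k\le t-1$. Then for every nonnegative integer $n$, $$\sum_{\substack{\lambda_{t\text{-core}}=\emptyset\\ |\lambda|=nt}}F_{\lambda}G_\lambda\sum_{\substack{\square\in\lambda\\ c_\square\equiv k\ (\mathrm{mod}\ t)}}c_\square^2=t\binom n2+k(t-k)n.$$
   Context: Partitions are identified with Young diagrams; the content of box $(i,j)$ (row $i$, column $j$) is $c_\square=j-i$; $h_\square$ is the hook length (boxes to its right in its row, plus below it in its column, plus one), $\mathcal H(\lambda)$ the multiset of hook lengths. The 01-sequence $(z_i)_{i\in\mathbb Z}$ of $\lambda$: traverse the boundary of the Young diagram from the bottom (infinite vertical ray below the first column) to the right (infinite horizontal ray right of the first row), labelling vertical edges $0$ and horizontal edges $1$, indexed so that $\#\{i\ge0:z_i=0\}=\#\{i<0:z_i=1\}$. Adding a $t$-hook means exchanging some $z_i=0,z_{i+t}=1$ into $1,0$; removing one is the reverse. $\lambda\ge_t\mu$ means $\lambda$ is obtained from $\mu$ by adding $t$-hooks. The $t$-core $\lambda_{t\text{-core}}$ is obtained by removing $t$-hooks until impossible (independent of choices). $F_{\lambda/\mu}$ (for $\lambda\ge_t\mu$): $F_{\mu/\mu}=1$ and $F_{\lambda/\mu}=\sum F_{\lambda^-/\mu}$ over all $\lambda^-$ with $\lambda\ge_t\lambda^-\ge_t\mu$, $|\lambda|-|\lambda^-|=t$; $F_\lambda=F_{\lambda/\lambda_{t\text{-core}}}$. $G_\lambda=1/\prod_{h\in\mathcal H(\lambda),\,t\mid h}h$. *)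

theory Defs
  imports "HOL-Number_Theory.Cong" "HOL-Library.Multiset" Complex_Main
begin

section \<open>Partitions, contents and hook lengths\<close>

definition is_partition :: "nat list \<Rightarrow> bool" where
  "is_partition \<mu> \<longleftrightarrow> sorted_wrt (\<ge>) \<mu> \<and> 0 \<notin> set \<mu>"

text \<open>Rows and columns are numbered from \<open>0\<close>; contents and hook lengths do not depend on this.\<close>

definition young :: "nat list \<Rightarrow> (nat \<times> nat) set" where
  "young \<mu> = {(i, j). i < length \<mu> \<and> j < \<mu> ! i}"

fun box_content :: "nat \<times> nat \<Rightarrow> int" where
  "box_content (i, j) = int j - int i"

fun hook_length :: "nat list \<Rightarrow> nat \<times> nat \<Rightarrow> nat" where
  "hook_length \<mu> (i, j) =
     card {j'. j < j' \<and> (i, j') \<in> young \<mu>} + card {i'. i < i' \<and> (i', j) \<in> young \<mu>} + 1"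

definition hook_lengths :: "nat list \<Rightarrow> nat multiset" where
  "hook_lengths \<mu> = image_mset (hook_length \<mu>) (mset_set (young \<mu>))"

section \<open>The 01-sequence\<close>

text \<open>
  A lattice point \<open>(r, c)\<close> is the top left corner of the box \<open>(r, c)\<close>. A unit edge lies on the boundary
  if the box below it or to its right is outside the diagram, while the box above it or to its left
  is in the diagram or does not exist; this includes the two infinite rays.
\<close>

definition vertical_boundary_edge :: "nat list \<Rightarrow> nat \<Rightarrow> nat \<Rightarrow> bool" where
  \<comment> \<open>the edge from \<open>(r + 1, c)\<close> up to \<open>(r, c)\<close>\<close>
  "vertical_boundary_edge \<mu> r c \<longleftrightarrow> (r, c) \<notin> young \<mu> \<and> (c = 0 \<or> (r, c - 1) \<in> young \<mu>)"

definition horizontal_boundary_edge :: "nat list \<Rightarrow> nat \<Rightarrow> nat \<Rightarrow> bool" where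
  \<comment> \<open>the edge from \<open>(r, c)\<close> right to \<open>(r, c + 1)\<close>\<close>
  "horizontal_boundary_edge \<mu> r c \<longleftrightarrow> (r, c) \<notin> young \<mu> \<and> (r = 0 \<or> (r - 1, c) \<in> young \<mu>)"

definition boundary_traversal :: "nat list \<Rightarrow> (int \<Rightarrow> nat) \<Rightarrow> (int \<Rightarrow> nat \<times> nat) \<Rightarrow> bool" where
  "boundary_traversal \<mu> z p \<longleftrightarrow>
     (\<forall>m. (z m = 0 \<and> (\<exists>r c. p m = (Suc r, c) \<and> p (m + 1) = (r, c) \<and> vertical_boundary_edge \<mu> r c)) \<or>
          (z m = 1 \<and> (\<exists>r c. p m = (r, c) \<and> p (m + 1) = (r, Suc c) \<and> horizontal_boundary_edge \<mu> r c)))"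

definition balanced_seq :: "(int \<Rightarrow> nat) \<Rightarrow> bool" where
  "balanced_seq z \<longleftrightarrow> finite {i. i \<ge> 0 \<and> z i = 0} \<and> finite {i. i < 0 \<and> z i = 1} \<and>
     card {i. i \<ge> 0 \<and> z i = 0} = card {i. i < 0 \<and> z i = 1}"

definition is_zero_one_seq :: "nat list \<Rightarrow> (int \<Rightarrow> nat) \<Rightarrow> bool" where
  "is_zero_one_seq \<mu> z \<longleftrightarrow> (\<exists>p. boundary_traversal \<mu> z p) \<and> balanced_seq z"

text \<open>Well-defined for partitions, see \<open>is_zero_one_seq_iff\<close> below.\<close>

definition zero_one_seq :: "nat list \<Rightarrow> int \<Rightarrow> nat" where
  "zero_one_seq \<mu> = (THE z. is_zero_one_seq \<mu> z)"

subsection \<open>Existence, uniqueness and an explicit formula\<close>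

definition row_len :: "nat list \<Rightarrow> nat \<Rightarrow> nat" where
  "row_len \<mu> i = (if i < length \<mu> then \<mu> ! i else 0)"

definition row_pos :: "nat list \<Rightarrow> nat \<Rightarrow> int" where
  "row_pos \<mu> i = int (row_len \<mu> i) - int i - 1"

definition beta_seq :: "nat list \<Rightarrow> int \<Rightarrow> nat" where
  "beta_seq \<mu> m = (if m \<in> range (row_pos \<mu>) then 0 else 1)"

lemma young_iff_row: "(i, j) \<in> young \<mu> \<longleftrightarrow> j < row_len \<mu> i"
  by (auto simp: young_def row_len_def)

lemma vertical_boundary_edge_iff: "vertical_boundary_edge \<mu> r c \<longleftrightarrow> c = row_len \<mu> r"
  by (auto simp: vertical_boundary_edge_def young_iff_row)

lemma horizontal_boundary_edge_iff:
  "horizontal_boundary_edge \<mu> r c \<longleftrightarrow> row_len \<mu> r \<le> c \<and> (r = 0 \<or> c < row_len \<mu> (r - 1))"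
  by (auto simp: horizontal_boundary_edge_def young_iff_row)

lemma row_antimono: "is_partition \<mu> \<Longrightarrow> i \<le> j \<Longrightarrow> row_len \<mu> j \<le> row_len \<mu> i"
  by (cases "i = j") (auto simp: is_partition_def row_len_def sorted_wrt_iff_nth_less)

lemma row_pos_less: "is_partition \<mu> \<Longrightarrow> i < j \<Longrightarrow> row_pos \<mu> j < row_pos \<mu> i"
  using row_antimono[of \<mu> i j] by (simp add: row_pos_def)

lemma row_pos_le: "is_partition \<mu> \<Longrightarrow> i \<le> j \<Longrightarrow> row_pos \<mu> j \<le> row_pos \<mu> i"
  using row_pos_less[of \<mu> i j] by (cases "i = j") auto

lemma row_pos_less_iff: "is_partition \<mu> \<Longrightarrow> row_pos \<mu> j < row_pos \<mu> i \<longleftrightarrow> i < j"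
  using row_pos_less row_pos_le by (metis not_less)

lemma inj_row_pos: "is_partition \<mu> \<Longrightarrow> inj (row_pos \<mu>)"
  by (rule injI) (metis less_irrefl linorder_less_linear row_pos_less)

lemma beta_seq_traversal:
  assumes "is_partition \<mu>"
  shows "\<exists>p. boundary_traversal \<mu> (beta_seq \<mu>) p"
proof -
  define R where "R m = (LEAST r. row_pos \<mu> r < m)" for m
  have ex: "row_pos \<mu> (length \<mu> + nat (- m)) < m" for m
    by (simp add: row_pos_def row_len_def)
  have R1: "row_pos \<mu> (R m) < m" for m
    unfolding R_def by (rule LeastI[of _ "length \<mu> + nat (- m)"]) (rule ex)
  have R2: "m \<le> row_pos \<mu> r" if "r < R m" for r m
    using that not_less_Least unfolding R_def by (metis not_less)
  have Reqm: "R m = r" if "row_pos \<mu> r < m" "r = 0 \<or> m \<le> row_pos \<mu> (r - 1)" for r m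
  proof (rule antisym)
    show "R m \<le> r" unfolding R_def by (rule Least_le) (rule that)
    show "r \<le> R m"
    proof (rule ccontr)
      assume "\<not> r \<le> R m"
      then have "R m \<le> r - 1" "r \<noteq> 0" by auto
      then have "row_pos \<mu> (r - 1) \<le> row_pos \<mu> (R m)"
        by (intro row_pos_le assms)
      with R1[of m] that \<open>r \<noteq> 0\<close> show False by auto
    qed
  qed
  have nonneg: "int (row_len \<mu> (R m)) \<le> m + int (R m)" for m
    using R1[of m] by (simp add: row_pos_def)
  define p where "p m = (R m, nat (m + int (R m)))" for m
  have "boundary_traversal \<mu> (beta_seq \<mu>) p"
    unfolding boundary_traversal_def
  proof
    fix m
    let ?A = "beta_seq \<mu> m = 0 \<and> (\<exists>r c. p m = (Suc r, c) \<and> p (m + 1) = (r, c) \<and> vertical_boundary_edge \<mu> r c)"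
    let ?B = "beta_seq \<mu> m = 1 \<and> (\<exists>r c. p m = (r, c) \<and> p (m + 1) = (r, Suc c) \<and> horizontal_boundary_edge \<mu> r c)"
    show "?A \<or> ?B"
    proof (cases "m \<in> range (row_pos \<mu>)")
      case True
      then obtain i where i: "m = row_pos \<mu> i" by auto
      have a: "R m = Suc i"
        by (rule Reqm) (use i assms row_pos_less[of \<mu> i "Suc i"] in auto)
      have "i = 0 \<or> m + 1 \<le> row_pos \<mu> (i - 1)"
        using i assms row_pos_less[of \<mu> "i - 1" i] by (cases "i = 0") auto
      then have b: "R (m + 1) = i"
        by (intro Reqm) (use i in auto)
      have "p m = (Suc i, row_len \<mu> i)" "p (m + 1) = (i, row_len \<mu> i)"
        unfolding p_def a b using i by (auto simp: row_pos_def)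
      then show ?thesis using True by (simp add: beta_seq_def vertical_boundary_edge_iff)
    next
      case False
      have c: "R m = 0 \<or> m + 1 \<le> row_pos \<mu> (R m - 1)"
      proof (cases "R m = 0")
        case r: False
        then have "m \<le> row_pos \<mu> (R m - 1)" by (intro R2) auto
        moreover have "m \<noteq> row_pos \<mu> (R m - 1)" using False by auto
        ultimately show ?thesis by auto
      qed auto
      have b: "R (m + 1) = R m"
        by (rule Reqm) (use R1[of m] c in auto)
      have "p (m + 1) = (R m, Suc (nat (m + int (R m))))"
        unfolding p_def b using nonneg[of m] by auto
      moreover have "horizontal_boundary_edge \<mu> (R m) (nat (m + int (R m)))"
        using nonneg[of m] c
        by (cases "R m = 0") (auto simp: horizontal_boundary_edge_iff row_pos_def)
      ultimately have ?B using False by (auto simp: p_def beta_seq_def)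
      then show ?thesis by blast
    qed
  qed
  then show ?thesis by blast
qed

lemma beta_seq_balanced:
  assumes "is_partition \<mu>"
  shows "balanced_seq (beta_seq \<mu>)"
proof -
  define L where "L = length \<mu>"
  define P where "P = {i. i < L \<and> row_pos \<mu> i \<ge> 0}"
  define N where "N = {i. i < L \<and> row_pos \<mu> i < 0}"
  have big: "row_pos \<mu> i = - int i - 1" if "i \<ge> L" for i
    using that by (simp add: row_pos_def row_len_def L_def)
  have small: "row_pos \<mu> i \<ge> - int L" if "i < L" for i
    using that by (simp add: row_pos_def)
  have inj: "inj_on (row_pos \<mu>) A" for A
    using inj_row_pos[OF assms] by (rule inj_on_subset) auto
  have fin: "finite P" "finite N" by (auto simp: P_def N_def)
  have Z: "{i. i \<ge> 0 \<and> beta_seq \<mu> i = 0} = row_pos \<mu> ` P"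
  proof -
    have "i < L" if "row_pos \<mu> i \<ge> 0" for i
      using big[of i] that by (cases "i < L") auto
    then show ?thesis by (auto simp: beta_seq_def P_def split: if_splits)
  qed
  have O: "{i. i < 0 \<and> beta_seq \<mu> i = 1} = {- int L..<0} - row_pos \<mu> ` N"
  proof (intro set_eqI iffI)
    fix m assume "m \<in> {i. i < 0 \<and> beta_seq \<mu> i = 1}"
    then have m: "m < 0" "m \<notin> range (row_pos \<mu>)" by (auto simp: beta_seq_def split: if_splits)
    have "m \<ge> - int L"
    proof (rule ccontr)
      assume "\<not> m \<ge> - int L"
      then have "row_pos \<mu> (nat (- m - 1)) = m" by (subst big) auto
      with m(2) show False by (metis rangeI)
    qed
    with m show "m \<in> {- int L..<0} - row_pos \<mu> ` N" by auto
  next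
    fix m assume m: "m \<in> {- int L..<0} - row_pos \<mu> ` N"
    have "m \<notin> range (row_pos \<mu>)"
    proof
      assume "m \<in> range (row_pos \<mu>)"
      then obtain i where i: "m = row_pos \<mu> i" by auto
      with m big[of i] have "i < L" by (cases "i < L") auto
      with i m show False by (auto simp: N_def)
    qed
    with m show "m \<in> {i. i < 0 \<and> beta_seq \<mu> i = 1}" by (auto simp: beta_seq_def)
  qed
  have "card P + card N = card (P \<union> N)"
    using fin by (subst card_Un_disjoint) (auto simp: P_def N_def)
  also have "P \<union> N = {..<L}" by (auto simp: P_def N_def)
  finally have PN: "card P + card N = L" by simp
  have "card ({- int L..<0} - row_pos \<mu> ` N) = L - card N"
    using small fin by (subst card_Diff_subset) (auto simp: N_def card_image[OF inj])
  then show ?thesis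
    unfolding balanced_seq_def Z O using fin PN by (simp add: card_image[OF inj])
qed

lemma traversal_shift:
  assumes "is_partition \<mu>" and tr: "boundary_traversal \<mu> z p"
  shows "\<exists>k. \<forall>m. z m = beta_seq \<mu> (m + k)"
proof -
  define d where "d m = int (snd (p m)) - int (fst (p m))" for m
  have step: "d (m + 1) = d m + 1" for m
    using spec[OF tr[unfolded boundary_traversal_def], of m] by (auto simp: d_def)
  have d: "d m = m + d 0" for m
  proof (induction m rule: int_induct[where k = 0])
    case (step1 i)
    then show ?case using step[of i] by simp
  next
    case (step2 i)
    then show ?case using step[of "i - 1"] by simp
  qed simp
  have "z m = beta_seq \<mu> (d m)" for m
  proof -
    from spec[OF tr[unfolded boundary_traversal_def vertical_boundary_edge_iff horizontal_boundary_edge_iff], of m]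
    consider
        (v) r c where "z m = 0" "p m = (Suc r, c)" "c = row_len \<mu> r"
      | (h) r c where "z m = 1" "p m = (r, c)" "row_len \<mu> r \<le> c" "r = 0 \<or> c < row_len \<mu> (r - 1)"
      by blast
    then show ?thesis
    proof cases
      case v
      then have "d m = row_pos \<mu> r" by (simp add: d_def row_pos_def)
      with v show ?thesis by (simp add: beta_seq_def)
    next
      case h
      have "d m \<noteq> row_pos \<mu> i" for i
      proof
        assume i: "d m = row_pos \<mu> i"
        have "row_pos \<mu> r < d m" using h by (simp add: d_def row_pos_def)
        with i have "i < r" using row_pos_less_iff[OF assms(1)] by simp
        then have "row_pos \<mu> (r - 1) \<le> d m"
          unfolding i by (intro row_pos_le assms) auto
        with h \<open>i < r\<close> show False by (auto simp: d_def row_pos_def)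
      qed
      with h show ?thesis by (auto simp: beta_seq_def)
    qed
  qed
  then have "z m = beta_seq \<mu> (m + d 0)" for m by (simp flip: d)
  then show ?thesis by blast
qed

lemma balanced_shift:
  assumes z: "\<And>i. z i = 0 \<or> z i = 1" and b: "balanced_seq z" and bk: "balanced_seq (\<lambda>m. z (m + k))"
  shows "k = 0"
proof -
  define A where "A k = {i. i \<ge> k \<and> z i = 0}" for k :: int
  define B where "B k = {i. i < k \<and> z i = 1}" for k :: int
  have A: "{i. i \<ge> 0 \<and> z (i + k) = 0} = (\<lambda>i. i - k) ` A k" for k
    by (rule set_eqI, rule iffI, rule_tac x = "x + k" in image_eqI) (auto simp: A_def)
  have B: "{i. i < 0 \<and> z (i + k) = 1} = (\<lambda>i. i - k) ` B k" for k
    by (rule set_eqI, rule iffI, rule_tac x = "x + k" in image_eqI) (auto simp: B_def)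
  have inj: "inj_on (\<lambda>i. i - k) S" for S and k :: int by (auto simp: inj_on_def)
  have *: "finite (A k)" "finite (B k)" "card (A k) = card (B k)"
    using bk unfolding balanced_seq_def A B by (auto simp: card_image inj finite_image_iff)
  have **: "finite (A 0)" "finite (B 0)" "card (A 0) = card (B 0)"
    using b unfolding balanced_seq_def by (auto simp: A_def B_def)
  have mono: False
    if "k < l" "finite (A k)" "finite (B k)" "card (A k) = card (B k)"
      "finite (A l)" "finite (B l)" "card (A l) = card (B l)" for k l
  proof -
    have sub: "A l \<subseteq> A k" "B k \<subseteq> B l" using that(1) by (auto simp: A_def B_def)
    have le: "card (A l) \<le> card (A k)" "card (B k) \<le> card (B l)"
      by (rule card_mono[OF that(2) sub(1)], rule card_mono[OF that(6) sub(2)])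
    from z[of k] show False
    proof
      assume "z k = 0"
      then have "k \<in> A k" "k \<notin> A l" using that(1) by (auto simp: A_def)
      with sub have "A l \<subset> A k" by blast
      then have "card (A l) < card (A k)" using that by (intro psubset_card_mono)
      then show False using le that by simp
    next
      assume "z k = 1"
      then have "k \<in> B l" "k \<notin> B k" using that(1) by (auto simp: B_def)
      with sub have "B k \<subset> B l" by blast
      then have "card (B k) < card (B l)" using that by (intro psubset_card_mono)
      then show False using le that by simp
    qed
  qed
  show ?thesis
    using mono[of 0 k] mono[of k 0] * ** by (cases k "0::int" rule: linorder_cases) auto
qed

theorem is_zero_one_seq_iff:
  assumes "is_partition \<mu>"
  shows "is_zero_one_seq \<mu> z \<longleftrightarrow> z = beta_seq \<mu>"
proof
  assume z: "is_zero_one_seq \<mu> z"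
  then obtain k where k: "\<And>m. z m = beta_seq \<mu> (m + k)"
    using traversal_shift[OF assms] unfolding is_zero_one_seq_def by blast
  have "k = 0"
  proof (rule balanced_shift[of "beta_seq \<mu>"])
    have "z = (\<lambda>m. beta_seq \<mu> (m + k))" using k by blast
    with z show "balanced_seq (\<lambda>m. beta_seq \<mu> (m + k))" by (simp add: is_zero_one_seq_def)
  qed (auto simp: beta_seq_def beta_seq_balanced assms)
  with k show "z = beta_seq \<mu>" by auto
qed (simp add: is_zero_one_seq_def beta_seq_traversal beta_seq_balanced assms)

corollary zero_one_seq_eq: "is_partition \<mu> \<Longrightarrow> zero_one_seq \<mu> = beta_seq \<mu>"
  by (simp add: zero_one_seq_def is_zero_one_seq_iff)

section \<open>Adding hooks, cores and the two weights\<close>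

definition add_hook :: "nat \<Rightarrow> nat list \<Rightarrow> nat list \<Rightarrow> bool" where
  "add_hook t \<mu> \<nu> \<longleftrightarrow> is_partition \<mu> \<and> is_partition \<nu> \<and>
     (\<exists>i. zero_one_seq \<mu> i = 0 \<and> zero_one_seq \<mu> (i + int t) = 1 \<and>
          zero_one_seq \<nu> = (zero_one_seq \<mu>)(i := 1, i + int t := 0))"

definition hook_ge :: "nat \<Rightarrow> nat list \<Rightarrow> nat list \<Rightarrow> bool" where
  "hook_ge t \<nu> \<mu> \<longleftrightarrow> (add_hook t)\<^sup>*\<^sup>* \<mu> \<nu>"

text \<open>A core admits no removal of a \<open>t\<close>-hook; the core of a partition is unique for \<open>t > 0\<close>.\<close>

definition t_core :: "nat \<Rightarrow> nat list \<Rightarrow> nat list" where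
  "t_core t \<mu> = (THE \<kappa>. hook_ge t \<mu> \<kappa> \<and> \<not> (\<exists>\<rho>. add_hook t \<rho> \<kappa>))"

text \<open>
  \<open>F_skew t \<nu> \<mu>\<close> stands for the number attached to \<open>\<nu>/\<mu>\<close>, where \<open>t > 0\<close> and \<open>hook_ge t \<nu> \<mu>\<close>. The
  condition \<open>0 < t\<close> is only there to make the recursion terminate.
\<close>

function F_skew :: "nat \<Rightarrow> nat list \<Rightarrow> nat list \<Rightarrow> nat" where
  "F_skew t \<nu> \<mu> =
     (if \<nu> = \<mu> then 1
      else \<Sum>\<rho> \<in> {\<rho>. 0 < t \<and> hook_ge t \<nu> \<rho> \<and> hook_ge t \<rho> \<mu> \<and> sum_list \<nu> = sum_list \<rho> + t}. F_skew t \<rho> \<mu>)"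
  by auto
termination
  by (relation "Wellfounded.measure (\<lambda>(t, \<nu>, \<mu>). sum_list \<nu>)") auto

declare F_skew.simps [simp del]

definition F_hook :: "nat \<Rightarrow> nat list \<Rightarrow> nat" where
  "F_hook t \<mu> = F_skew t \<mu> (t_core t \<mu>)"

definition G_hook :: "nat \<Rightarrow> nat list \<Rightarrow> real" where
  "G_hook t \<mu> = 1 / real (\<Prod>h \<in># filter_mset (\<lambda>h. t dvd h) (hook_lengths \<mu>). h)"

end

(*
  By F_lambda = sum F_{lambda^-}, everything reduces to one step: for a partition mu with empty core
  and size n t, the weights G(mu+) / G(mu) over the partitions mu+ obtained by adding a t-hook sum to 1,
  and the square of the unique content = k (mod t) in the added strip has mean t n + k (t - k).
  On the t runners of the abacus (bead set) the weights split into t transition measures, each of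
  total mass 1/t, whose first moments come from Lagrange interpolation: the mean of a quadratic
  polynomial against the transition measure is the top coefficient of an explicit polynomial.
*)

theory Submission
  imports Defs "HOL-Computational_Algebra.Polynomial"
begin

section \<open>Moments of the transition measure\<close>

text \<open>With \<open>t * (n + 1)\<close> beads the empty partition has \<open>n + 1\<close> beads
  on every runner, and adding hooks keeps these numbers; this is how the empty core enters. Moving
  the bead m of runner r adds a box of content c = m - n to the partition displayed on that runner,
  and the content of residue k in the strip is t * c + \<kappa>, with \<kappa> = k - t on the k
  runners r < k and \<kappa> = k on the other t - k. Under the normalized transition measure of a
  runner, c has mean 0 and second moment equal to the size of the runner's partition. So the cross
  terms vanish, the sizes add up to n and contribute t * n, and the mean of \<kappa>^2 over the
  runners is k * (t - k). The obstacle is that one added hook changes many hook lengths at once. The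
  product of the hooks divisible by t is therefore rewritten as a quotient of restricted factorials
  by differences of beads, where only the factors containing the moved bead change.\<close>

lemma lagrange_top_coeff:
  fixes p :: "'a::field poly"
  assumes fin: "finite S" and deg: "degree p < card S"
  shows "(\<Sum>s\<in>S. poly p s / (\<Prod>r\<in>S - {s}. s - r)) = coeff p (card S - 1)"
proof -
  define c where "c s = poly p s / (\<Prod>r\<in>S - {s}. s - r)" for s
  define q where "q s = (\<Prod>r\<in>S - {s}. [:- r, 1:])" for s
  have degq: "degree (q s) = card S - 1" and lead: "coeff (q s) (card S - 1) = 1" if "s \<in> S" for s
  proof -
    show d: "degree (q s) = card S - 1"
      unfolding q_def using fin that by (subst degree_prod_sum_eq) auto
    show "coeff (q s) (card S - 1) = 1"
      using lead_coeff_prod[of "\<lambda>r. [:- r, 1:]" "S - {s}"] d by (simp add: q_def)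
  qed
  \<comment> \<open>Lagrange interpolation. Each \<open>q s\<close> is monic of degree
    \<open>card S - 1\<close>, so the claim is the comparison of top coefficients.\<close>
  have "p = (\<Sum>s\<in>S. smult (c s) (q s))"
  proof (rule poly_eqI_degree[of S])
    fix x assume x: "x \<in> S"
    have "poly (q s) x = 0" if "s \<in> S - {x}" for s
      using that x fin by (auto simp: q_def poly_prod prod_zero_iff)
    then have "poly (\<Sum>s\<in>S. smult (c s) (q s)) x = c x * poly (q x) x"
      using fin x by (simp add: poly_sum sum.remove[OF fin x])
    moreover have "poly (q x) x = (\<Prod>r\<in>S - {x}. x - r)"
      by (simp add: q_def poly_prod)
    moreover have "(\<Prod>r\<in>S - {x}. x - r) \<noteq> 0" using fin by (auto simp: prod_zero_iff)
    ultimately show "poly p x = poly (\<Sum>s\<in>S. smult (c s) (q s)) x"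
      by (simp add: c_def)
  next
    show "degree (\<Sum>s\<in>S. smult (c s) (q s)) < card S"
    proof -
      have "degree (\<Sum>s\<in>S. smult (c s) (q s)) \<le> card S - 1"
        using fin degq by (intro degree_sum_le) (auto intro!: degree_smult_le[THEN order.trans])
      then show ?thesis using deg by linarith
    qed
  qed (rule deg)
  then have "coeff p (card S - 1) = (\<Sum>s\<in>S. c s * coeff (q s) (card S - 1))"
    by (metis (no_types, lifting) coeff_smult coeff_sum sum.cong)
  with lead show ?thesis by (simp add: c_def)
qed

text \<open>Vieta's formulas, with the second elementary symmetric sum expressed by power sums.
  Multiplying by powers of the variable through \<open>pCons 0\<close> moves all three coefficients
  to the index \<open>card X\<close>; indices such as \<open>card X - 1\<close> would truncate for
  small \<open>X\<close> and point at the wrong coefficient.\<close>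

lemma coeff_prod_linear_factors:
  fixes f :: "'b \<Rightarrow> real"
  assumes "finite X"
  defines "P \<equiv> \<Prod>x\<in>X. [:- f x, 1:]"
  shows "coeff P (card X) = 1" and "\<And>i. card X < i \<Longrightarrow> coeff P i = 0"
    and "coeff (pCons 0 P) (card X) = - sum f X"
    and "coeff (pCons 0 (pCons 0 P)) (card X) = ((sum f X)\<^sup>2 - (\<Sum>x\<in>X. (f x)\<^sup>2)) / 2"
proof -
  have "coeff P (card X) = 1 \<and> (\<forall>i>card X. coeff P i = 0) \<and>
    coeff (pCons 0 P) (card X) = - sum f X \<and>
    coeff (pCons 0 (pCons 0 P)) (card X) = ((sum f X)\<^sup>2 - (\<Sum>x\<in>X. (f x)\<^sup>2)) / 2"
    unfolding P_def using assms(1)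
  proof (induction X rule: finite_induct)
    case (insert x X)
    have ge: "coeff (pCons 0 (\<Prod>x\<in>X. [:- f x, 1:])) i = 0" if "i > Suc (card X)" for i
      using insert.IH that by (cases i) auto
    have d: "coeff (pCons 0 (p - smult c q)) i = coeff (pCons 0 p) i - c * coeff (pCons 0 q) i"
      for p q :: "real poly" and c i by (cases i) auto
    show ?case using insert ge
      by (simp add: d) (simp add: power2_eq_square field_simps)
  qed (auto simp: coeff_pCons split: nat.splits)
  then show "coeff P (card X) = 1" and "\<And>i. card X < i \<Longrightarrow> coeff P i = 0"
    and "coeff (pCons 0 P) (card X) = - sum f X"
    and "coeff (pCons 0 (pCons 0 P)) (card X) = ((sum f X)\<^sup>2 - (\<Sum>x\<in>X. (f x)\<^sup>2)) / 2"
    by auto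
qed

text \<open>All coefficients from index \<open>card X\<close> upwards are recorded, so that two such
  products can be subtracted: above \<open>card X\<close> they will cancel, and at
  \<open>card X\<close> the moment is read off.\<close>

lemma coeff_quadratic_mult_linear_factors:
  fixes f :: "'b \<Rightarrow> real" and a b :: real
  assumes "finite X"
  defines "P \<equiv> [:a, b, 1:] * (\<Prod>x\<in>X. [:- f x, 1:])"
  shows "coeff P (card X) = a - b * sum f X + ((sum f X)\<^sup>2 - (\<Sum>x\<in>X. (f x)\<^sup>2)) / 2"
    and "coeff P (Suc (card X)) = b - sum f X"
    and "coeff P (Suc (Suc (card X))) = 1"
    and "\<And>i. Suc (Suc (card X)) < i \<Longrightarrow> coeff P i = 0"
proof -
  let ?Q = "\<Prod>x\<in>X. [:- f x, 1:]"
  note c = coeff_prod_linear_factors[OF assms(1), where f = f]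
  have P: "P = smult a ?Q + smult b (pCons 0 ?Q) + pCons 0 (pCons 0 ?Q)"
    by (simp add: P_def)
  show "coeff P (card X) = a - b * sum f X + ((sum f X)\<^sup>2 - (\<Sum>x\<in>X. (f x)\<^sup>2)) / 2"
    unfolding P coeff_add coeff_smult c by simp
  show "coeff P (Suc (card X)) = b - sum f X" "coeff P (Suc (Suc (card X))) = 1"
    unfolding P coeff_add coeff_smult coeff_pCons_Suc c using c(2) by simp_all
  show "coeff P i = 0" if "Suc (Suc (card X)) < i" for i
  proof -
    have "i = Suc (Suc (i - 2))" "card X < i - 2" using that by auto
    then obtain j where "i = Suc (Suc j)" "card X < j" by blast
    then show ?thesis unfolding P coeff_add coeff_smult using c(2) by simp
  qed
qed

text \<open>For the bead set of a partition and a movable bead \<open>x\<close>, this is the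
  Plancherel transition probability: the quotient of the hook products before and after
  \<open>x\<close> moves to \<open>x + 1\<close>. The denominator \<open>x + 1\<close> is the
  quotient of (x + 1)! by x!, the other factors are quotients of bead differences.\<close>

definition transition_weight :: "real set \<Rightarrow> real \<Rightarrow> real" where
  "transition_weight X x = (\<Prod>y\<in>X - {x}. (x + 1 - y) / (x - y)) / (x + 1)"

text \<open>
  Up to the node \<open>-1\<close>, whose term vanishes because \<open>0 \<in> X\<close>, the sum is a divided difference of
  \<open>(u\<^sup>2 + b u + a) P(u + 1)\<close> for \<open>P(u) = \<Prod>(u - x)\<close>. Subtracting a multiple of the node polynomial
  \<open>(u + 1) P(u)\<close> makes the degree at most \<open>card X\<close>.
\<close>

lemma transition_weight_quadratic:
  assumes fin: "finite X" and z: "0 \<in> X" and m: "- 1 \<notin> X"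
  shows "(\<Sum>x\<in>X. transition_weight X x * (x\<^sup>2 + b * x + a)) =
    \<Sum>X + a + b * (real (card X) - 1) + (real (card X) - 1) * (real (card X) - 2) / 2"
proof -
  define N where "N = card X"
  \<comment> \<open>The polynomial \<open>[:\<beta>, \<beta> + 1, 1:]\<close> is (u + 1) (u +
    \<beta>), so its product with \<open>P\<close> is u + \<beta> times the node polynomial. The
    coefficients at N + 2 are both 1, and this \<beta> makes those at N + 1 agree.\<close>
  define \<beta> where "\<beta> = b + real N - 1"
  define T where "T = (\<Prod>x\<in>X. [:- (x - 1), 1:])"
  define P where "P = (\<Prod>x\<in>X. [:- x, 1:])"
  define R where "R = [:a, b, 1:] * T - [:\<beta>, \<beta> + 1, 1:] * P"
  have e: "(\<Sum>x\<in>X. x - 1) = \<Sum>X - N" by (simp add: sum_subtractf N_def)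
  have p2: "(\<Sum>x\<in>X. (x - 1)\<^sup>2) = (\<Sum>x\<in>X. x\<^sup>2) - 2 * \<Sum>X + N"
    by (simp add: power2_diff sum_subtractf sum.distrib N_def sum_distrib_left)
  note cT = coeff_quadratic_mult_linear_factors[OF fin, where a = a and b = b and f = "\<lambda>x. x - 1", folded T_def N_def, unfolded e p2]
  note cP = coeff_quadratic_mult_linear_factors[OF fin, where a = \<beta> and b = "\<beta> + 1" and f = "\<lambda>x. x", folded P_def N_def]
  have cN: "coeff R N = \<Sum>X + a + b * (real N - 1) + (real N - 1) * (real N - 2) / 2"
    unfolding R_def coeff_diff cT cP unfolding \<beta>_def by (simp add: power2_eq_square field_simps)
  have "coeff R i = 0" if i: "i > N" for i
  proof -
    consider "i = Suc N" | "i = Suc (Suc N)" | "i > Suc (Suc N)" using i by (metis Suc_lessI)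
    then show ?thesis
      by cases (simp_all only: R_def coeff_diff cT cP, simp_all add: \<beta>_def)
  qed
  then have degR: "degree R \<le> N" by (intro degree_le) auto
  define S where "S = insert (- 1) X"
  have S: "finite S" "card S = Suc N" using fin m by (auto simp: S_def N_def)
  have PX: "poly P x = 0" if "x \<in> X" for x using that fin by (auto simp: P_def poly_prod prod_zero_iff)
  have TX: "poly T x = (\<Prod>y\<in>X. x + 1 - y)" for x by (simp add: T_def poly_prod algebra_simps)
  have w: "poly R x / (\<Prod>r\<in>S - {x}. x - r) = transition_weight X x * (x\<^sup>2 + b * x + a)" if x: "x \<in> X" for x
  proof -
    have "S - {x} = insert (- 1) (X - {x})" using m x by (auto simp: S_def)
    then have d: "(\<Prod>r\<in>S - {x}. x - r) = (x + 1) * (\<Prod>y\<in>X - {x}. x - y)" using fin m by simp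
    have "poly R x = (x\<^sup>2 + b * x + a) * (\<Prod>y\<in>X - {x}. x + 1 - y)"
      using prod.remove[OF fin x, of "\<lambda>y. x + 1 - y"]
      by (simp add: R_def PX[OF x] TX power2_eq_square algebra_simps)
    then show ?thesis by (simp add: d transition_weight_def prod_dividef mult.commute)
  qed
  have "poly T (- 1) = 0"
    unfolding TX by (rule prod_zero[OF fin]) (use z in auto)
  then have "poly R (- 1) = 0" by (simp add: R_def algebra_simps)
  then have "(\<Sum>s\<in>S. poly R s / (\<Prod>r\<in>S - {s}. s - r)) =
      (\<Sum>x\<in>X. transition_weight X x * (x\<^sup>2 + b * x + a))"
    using fin m w by (simp add: S_def)
  with lagrange_top_coeff[OF S(1), of R] degR S(2) cN show ?thesis by (simp add: N_def)
qed

text \<open>The moment formula is affine in the constant term, so the total mass is the difference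
  of two of its instances.\<close>

corollary transition_weight_sum:
  assumes "finite X" "0 \<in> X" "- 1 \<notin> X"
  shows "(\<Sum>x\<in>X. transition_weight X x) = 1"
  using transition_weight_quadratic[OF assms, of 0 1] transition_weight_quadratic[OF assms, of 0 0]
  by (simp add: distrib_left sum.distrib)

section \<open>Bead sets\<close>

text \<open>Adding \<open>M\<close> to the positions of the zeros of the 01-sequence makes those of the first \<open>M \<ge> length \<mu>\<close>
  rows natural numbers; all positions below \<open>-M\<close> carry a zero.\<close>

definition bead :: "nat \<Rightarrow> nat list \<Rightarrow> nat \<Rightarrow> nat" where
  "bead M \<mu> i = row_len \<mu> i + (M - Suc i)"

definition beads :: "nat \<Rightarrow> nat list \<Rightarrow> nat set" where
  "beads M \<mu> = bead M \<mu> ` {..<M}"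

lemma row_len_eq_0: "length \<mu> \<le> i \<Longrightarrow> row_len \<mu> i = 0"
  by (simp add: row_len_def)

lemma row_len_pos: "is_partition \<mu> \<Longrightarrow> i < length \<mu> \<Longrightarrow> 0 < row_len \<mu> i"
  using nth_mem[of i \<mu>] by (cases "\<mu> ! i = 0") (simp_all add: row_len_def is_partition_def)

lemma bead_less: "is_partition \<mu> \<Longrightarrow> i < j \<Longrightarrow> j < M \<Longrightarrow> bead M \<mu> j < bead M \<mu> i"
  using row_antimono[of \<mu> i j] by (simp add: bead_def)

lemma inj_on_bead: "is_partition \<mu> \<Longrightarrow> inj_on (bead M \<mu>) {..<M}"
  by (rule linorder_inj_onI') (simp add: bead_less less_imp_neq[THEN not_sym])

lemma finite_beads [simp]: "finite (beads M \<mu>)"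
  by (simp add: beads_def)

lemma card_beads: "is_partition \<mu> \<Longrightarrow> card (beads M \<mu>) = M"
  by (simp add: beads_def card_image inj_on_bead)

lemma beads_Nil [simp]: "beads M [] = {..<M}"
proof -
  have "x \<in> bead M [] ` {..<M}" if "x < M" for x
    using that by (intro image_eqI[of _ _ "M - Suc x"]) (auto simp: bead_def row_len_def)
  then show ?thesis by (auto simp: beads_def bead_def row_len_def)
qed

text \<open>Empty rows fill the lowest sites. This is the reason for keeping \<open>t\<close> spare
  beads: no bead from below site 0 can be moved into view, and every runner has a bead at 0, as the
  transition measures require.\<close>

lemma small_in_beads:
  assumes "length \<mu> + t \<le> M" "x < t"
  shows "x \<in> beads M \<mu>"
proof -
  have "x = bead M \<mu> (M - Suc x)" using assms by (simp add: bead_def row_len_eq_0)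
  moreover have "M - Suc x < M" using assms by simp
  ultimately show ?thesis unfolding beads_def by blast
qed

lemma row_pos_range_iff_beads:
  assumes "length \<mu> \<le> M"
  shows "int x - int M \<in> range (row_pos \<mu>) \<longleftrightarrow> x \<in> beads M \<mu>"
proof
  assume "int x - int M \<in> range (row_pos \<mu>)"
  then obtain i where i: "int x - int M = row_pos \<mu> i" by auto
  then have "i < M" using assms row_len_eq_0[of \<mu> i] by (cases "i < M") (auto simp: row_pos_def)
  moreover have "x = bead M \<mu> i" using i \<open>i < M\<close> by (simp add: row_pos_def bead_def)
  ultimately show "x \<in> beads M \<mu>" by (auto simp: beads_def)
next
  assume "x \<in> beads M \<mu>"
  then obtain i where "i < M" "x = bead M \<mu> i" by (auto simp: beads_def)
  then have "int x - int M = row_pos \<mu> i" by (simp add: row_pos_def bead_def)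
  then show "int x - int M \<in> range (row_pos \<mu>)" by blast
qed

lemma row_pos_range_low:
  assumes "length \<mu> \<le> M" "m < - int M"
  shows "m \<in> range (row_pos \<mu>)"
proof -
  have "m = row_pos \<mu> (nat (- m - 1))" using assms by (simp add: row_pos_def row_len_eq_0)
  then show ?thesis by blast
qed

lemma row_pos_range_beads:
  assumes "length \<mu> \<le> M"
  shows "m \<in> range (row_pos \<mu>) \<longleftrightarrow> m < - int M \<or> nat (m + int M) \<in> beads M \<mu>"
proof (cases "m < - int M")
  case False
  then show ?thesis using row_pos_range_iff_beads[OF assms, of "nat (m + int M)"] by simp
qed (use row_pos_range_low[OF assms] in auto)

text \<open>In decreasing order the beads belong to the rows 0, 1, and so on, so the set alone
  recovers every row length.\<close>

lemma beads_inject: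
  assumes p: "is_partition \<mu>" "is_partition \<nu>" and le: "length \<mu> \<le> M" "length \<nu> \<le> M"
    and eq: "beads M \<mu> = beads M \<nu>"
  shows "\<mu> = \<nu>"
proof -
  have s: "rev (map (bead M \<mu>) [0..<M]) = sorted_list_of_set (beads M \<mu>)" if "is_partition \<mu>" for \<mu>
  proof (rule sorted_distinct_set_unique)
    show "sorted (rev (map (bead M \<mu>) [0..<M]))"
    proof -
      have "sorted_wrt (\<lambda>i j. bead M \<mu> j \<le> bead M \<mu> i) [0..<M]"
        by (auto simp: sorted_wrt_iff_nth_less intro!: less_imp_le bead_less[OF that])
      then show ?thesis by (simp only: sorted_wrt_rev sorted_wrt_map)
    qed
    show "distinct (rev (map (bead M \<mu>) [0..<M]))"
      using inj_on_bead[OF that, of M] by (simp add: distinct_map lessThan_atLeast0)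
    show "set (rev (map (bead M \<mu>) [0..<M])) = set (sorted_list_of_set (beads M \<mu>))"
      by (auto simp: beads_def)
  qed auto
  have "map (bead M \<mu>) [0..<M] = map (bead M \<nu>) [0..<M]"
    using s[OF p(1)] s[OF p(2)] eq by (metis rev_rev_ident)
  then have "bead M \<mu> i = bead M \<nu> i" if "i < M" for i
    using that by auto
  then have r: "row_len \<mu> i = row_len \<nu> i" for i
  proof (cases "i < M")
    case True
    with \<open>\<And>i. i < M \<Longrightarrow> bead M \<mu> i = bead M \<nu> i\<close>[of i] show ?thesis by (simp add: bead_def)
  next
    case False
    then show ?thesis using le by (simp add: row_len_eq_0)
  qed
  \<comment> \<open>\<open>row_len\<close> is padded by zeros; it still determines the length
    because a partition has no zero part.\<close>
  have len: "length \<mu> \<le> length \<nu>"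
    if "is_partition \<mu>" "\<And>i. row_len \<mu> i = row_len \<nu> i" for \<mu> \<nu>
    using row_len_pos[OF that(1), of "length \<nu>"] that(2)[of "length \<nu>"] row_len_eq_0[of \<nu> "length \<nu>"]
    by (cases "length \<nu> < length \<mu>") auto
  show ?thesis
  proof (rule nth_equalityI)
    show "length \<mu> = length \<nu>" using len[OF p(1) r] len[OF p(2) r[symmetric]] by simp
    then show "\<mu> ! i = \<nu> ! i" if "i < length \<mu>" for i
      using r[of i] that by (simp add: row_len_def)
  qed
qed

text \<open>The zeros of a weakly decreasing list stand at its end, so dropping them only truncates
  it.\<close>

lemma row_len_filter_pos:
  assumes "sorted_wrt (\<ge>) xs"
  shows "row_len (filter (\<lambda>x. 0 < x) xs) i = (if i < length xs then xs ! i else 0)"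
  using assms
proof (induction xs arbitrary: i)
  case (Cons x xs)
  show ?case
  proof (cases "x = 0")
    case True
    then have z: "\<forall>y\<in>set xs. y = 0" using Cons.prems by auto
    then have "filter (\<lambda>x. 0 < x) xs = []" by (auto simp: filter_empty_conv)
    then show ?thesis using True z by (auto simp: row_len_def nth_Cons split: nat.splits)
  next
    case False
    then show ?thesis
      using Cons.IH[of "i - 1"] Cons.prems by (cases i) (auto simp: row_len_def split: if_splits)
  qed
qed (simp add: row_len_def)

text \<open>Subtracting the staircase 0, 1, ..., M - 1 from the increasing enumeration of
  \<open>Y\<close> leaves the row lengths in reverse order, up to zeros.\<close>

lemma ex_partition_beads:
  assumes "finite Y" "card Y = M"
  shows "\<exists>\<mu>. is_partition \<mu> \<and> length \<mu> \<le> M \<and> beads M \<mu> = Y"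
proof -
  define ys where "ys = sorted_list_of_set Y"
  have ys: "length ys = M" "sorted ys" "distinct ys" "set ys = Y" using assms by (auto simp: ys_def)
  have sl: "ys ! i < ys ! j" if "i < j" "j < M" for i j
    using ys that by (simp add: sorted_wrt_nth_less strict_sorted_iff)
  \<comment> \<open>This makes the differences ys ! i - i weakly increasing; its case i = 0 shows
    that the natural subtraction in \<open>xs\<close> never truncates.\<close>
  have step: "ys ! i + (j - i) \<le> ys ! j" if "i \<le> j" "j < M" for i j
    using that(1) that
  proof (induction j rule: dec_induct)
    case (step n)
    then show ?case using sl[of n "Suc n"] by simp
  qed simp
  define xs where "xs = map (\<lambda>i. ys ! (M - Suc i) - (M - Suc i)) [0..<M]"
  have sorted: "sorted_wrt (\<ge>) xs"
  proof -
    have "ys ! (M - Suc j) - (M - Suc j) \<le> ys ! (M - Suc i) - (M - Suc i)" if "i < j" "j < M" for i j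
      using step[of "M - Suc j" "M - Suc i"] step[of 0 "M - Suc j"] that by linarith
    then show ?thesis by (auto simp: sorted_wrt_iff_nth_less xs_def)
  qed
  define \<mu> where "\<mu> = filter (\<lambda>x. 0 < x) xs"
  have "is_partition \<mu>"
    using sorted by (auto simp: is_partition_def \<mu>_def sorted_wrt_filter)
  moreover have "length \<mu> \<le> M"
    unfolding \<mu>_def by (rule order.trans[OF length_filter_le]) (simp add: xs_def)
  moreover have "beads M \<mu> = Y"
  proof -
    have b: "bead M \<mu> i = ys ! (M - Suc i)" if "i < M" for i
      using that step[of 0 "M - Suc i"] by (simp add: bead_def \<mu>_def row_len_filter_pos[OF sorted]) (simp add: xs_def)
    have "beads M \<mu> = (\<lambda>i. ys ! (M - Suc i)) ` {..<M}"
      unfolding beads_def by (rule image_cong) (auto simp: b)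
    also have "\<dots> = (!) ys ` {..<M}"
    proof -
      have "(\<lambda>i. M - Suc i) ` {..<M} = {..<M}"
      proof safe
        fix x assume "x < M"
        then show "x \<in> (\<lambda>i. M - Suc i) ` {..<M}" by (intro image_eqI[of _ _ "M - Suc x"]) auto
      qed auto
      then show ?thesis by (metis image_image)
    qed
    also have "\<dots> = Y" using ys by (auto simp: in_set_conv_nth)
    finally show ?thesis .
  qed
  ultimately show ?thesis by blast
qed

section \<open>Hook additions as moves of beads\<close>

lemma zero_one_seq_beads:
  assumes "is_partition \<mu>" "length \<mu> \<le> M"
  shows "zero_one_seq \<mu> m = (if m < - int M \<or> nat (m + int M) \<in> beads M \<mu> then 0 else 1)"
  using assms by (simp add: zero_one_seq_eq beta_seq_def row_pos_range_beads)

lemma add_hook_imp_beads: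
  assumes add: "add_hook t \<mu> \<nu>" and M: "length \<mu> + t \<le> M" "length \<nu> \<le> M"
  shows "\<exists>x\<in>beads M \<mu>. x + t \<notin> beads M \<mu> \<and> beads M \<nu> = insert (x + t) (beads M \<mu> - {x})"
proof -
  have p: "is_partition \<mu>" "is_partition \<nu>" using add by (auto simp: add_hook_def)
  have M': "length \<mu> \<le> M" using M by simp
  note z\<mu> = zero_one_seq_beads[OF p(1) M'] and z\<nu> = zero_one_seq_beads[OF p(2) M(2)]
  obtain i where i: "zero_one_seq \<mu> i = 0" "zero_one_seq \<mu> (i + int t) = 1"
    and \<nu>: "zero_one_seq \<nu> = (zero_one_seq \<mu>)(i := 1, i + int t := 0)"
    using add by (auto simp: add_hook_def)
  have ge: "- int M \<le> i"
  proof (rule ccontr)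
    assume "\<not> - int M \<le> i"
    then have "nat (i + int t + int M) < t \<or> i + int t < - int M" by linarith
    then show False using i(2) small_in_beads[OF M(1)] by (auto simp: z\<mu>)
  qed
  define x where "x = nat (i + int M)"
  have ix: "i = int x - int M" using ge by (simp add: x_def)
  have "x \<in> beads M \<mu>" using i(1) ge by (auto simp: z\<mu> x_def split: if_splits)
  moreover have xt: "x + t \<notin> beads M \<mu>"
  proof
    assume a: "x + t \<in> beads M \<mu>"
    have "nat (i + int t + int M) = x + t" using ix by simp
    with a i(2) show False by (auto simp: z\<mu>)
  qed
  moreover have "y \<in> beads M \<nu> \<longleftrightarrow> y \<in> insert (x + t) (beads M \<mu> - {x})" for y
  proof -
    have "y \<in> beads M \<nu> \<longleftrightarrow> zero_one_seq \<nu> (int y - int M) = 0" by (simp add: z\<nu>)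
    also have "\<dots> \<longleftrightarrow> y \<in> insert (x + t) (beads M \<mu> - {x})"
      unfolding \<nu> using ix by (auto simp: z\<mu>)
    finally show ?thesis .
  qed
  ultimately show ?thesis by blast
qed

lemma add_hookI_beads:
  assumes p: "is_partition \<mu>" "is_partition \<nu>" and M: "length \<mu> \<le> M" "length \<nu> \<le> M"
    and x: "x \<in> beads M \<mu>" "x + t \<notin> beads M \<mu>" and \<nu>: "beads M \<nu> = insert (x + t) (beads M \<mu> - {x})"
  shows "add_hook t \<mu> \<nu>"
proof -
  note z\<mu> = zero_one_seq_beads[OF p(1) M(1)] and z\<nu> = zero_one_seq_beads[OF p(2) M(2)]
  define i where "i = int x - int M"
  have "nat (i + int t + int M) = x + t" "nat (i + int M) = x" by (auto simp: i_def)
  then have "zero_one_seq \<mu> i = 0" "zero_one_seq \<mu> (i + int t) = 1"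
    using x by (auto simp: z\<mu> i_def)
  moreover have "zero_one_seq \<nu> = (zero_one_seq \<mu>)(i := 1, i + int t := 0)"
  proof
    fix m
    show "zero_one_seq \<nu> m = ((zero_one_seq \<mu>)(i := 1, i + int t := 0)) m"
    proof (cases "m < - int M")
      case True
      then show ?thesis by (auto simp: z\<mu> z\<nu> i_def)
    next
      case False
      then have "m = int (nat (m + int M)) - int M" by simp
      then obtain y where "m = int y - int M" by blast
      then show ?thesis using x by (auto simp: z\<mu> z\<nu> \<nu> i_def)
    qed
  qed
  ultimately show ?thesis using p by (auto simp: add_hook_def)
qed

section \<open>Contents and size in terms of beads\<close>

lemma finite_young [simp]: "finite (young \<mu>)"
proof -
  have "young \<mu> = Sigma {..<length \<mu>} (\<lambda>i. {..<\<mu> ! i})" by (auto simp: young_def)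
  then show ?thesis by simp
qed

lemma young_Sigma:
  assumes "length \<mu> \<le> M"
  shows "young \<mu> = Sigma {..<M} (\<lambda>i. {..<row_len \<mu> i})"
  using assms by (auto simp: young_iff_row row_len_def split: if_splits)

lemma card_young: "card (young \<mu>) = sum_list \<mu>"
proof -
  have "card (young \<mu>) = (\<Sum>i<length \<mu>. row_len \<mu> i)"
    by (subst young_Sigma[OF order.refl]) simp
  also have "\<dots> = sum_list \<mu>" by (simp add: sum_list_sum_nth lessThan_atLeast0 row_len_def)
  finally show ?thesis .
qed

text \<open>Row \<open>i\<close> has the contents \<open>-i, \<dots>, \<mu>\<^sub>i - i - 1\<close>; after adding \<open>M - 1\<close> they lie between the bead
  of row \<open>i\<close> of the empty partition and that of \<open>\<mu>\<close>.\<close>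

lemma sum_contents_beads:
  fixes f :: "int \<Rightarrow> 'a::ab_group_add"
  assumes p: "is_partition \<mu>" and M: "length \<mu> \<le> M"
  shows "(\<Sum>b\<in>young \<mu>. f (box_content b)) =
    (\<Sum>x\<in>beads M \<mu>. \<Sum>y<x. f (int y + 1 - int M)) - (\<Sum>x<M. \<Sum>y<x. f (int y + 1 - int M))"
proof -
  define g where "g y = f (int y + 1 - int M)" for y
  have row: "(\<Sum>j<row_len \<mu> i. f (box_content (i, j))) = (\<Sum>y<bead M \<mu> i. g y) - (\<Sum>y<M - Suc i. g y)"
    if "i < M" for i
  proof -
    have "(\<Sum>y<bead M \<mu> i. g y) = (\<Sum>y<M - Suc i. g y) + (\<Sum>y\<in>{M - Suc i..<bead M \<mu> i}. g y)"
      by (subst sum.union_disjoint[symmetric]) (auto simp: bead_def intro!: sum.cong)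
    also have "(\<Sum>y\<in>{M - Suc i..<bead M \<mu> i}. g y) = (\<Sum>j<row_len \<mu> i. g (j + (M - Suc i)))"
      using sum.shift_bounds_nat_ivl[of g 0 "M - Suc i" "row_len \<mu> i"]
      by (simp add: bead_def lessThan_atLeast0)
    also have "\<dots> = (\<Sum>j<row_len \<mu> i. f (box_content (i, j)))"
      using that by (intro sum.cong) (auto simp: g_def of_nat_diff intro!: arg_cong[of _ _ f])
    finally show ?thesis by simp
  qed
  have "(\<Sum>b\<in>young \<mu>. f (box_content b)) = (\<Sum>i<M. \<Sum>j<row_len \<mu> i. f (box_content (i, j)))"
    by (subst young_Sigma[OF M], subst sum.Sigma) (auto intro!: sum.cong)
  also have "\<dots> = (\<Sum>i<M. \<Sum>y<bead M \<mu> i. g y) - (\<Sum>i<M. \<Sum>y<M - Suc i. g y)"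
    by (simp add: row sum_subtractf del: box_content.simps)
  also have "(\<Sum>i<M. \<Sum>y<bead M \<mu> i. g y) = (\<Sum>x\<in>beads M \<mu>. \<Sum>y<x. g y)"
    unfolding beads_def by (simp add: sum.reindex[OF inj_on_bead[OF p]])
  also have "(\<Sum>i<M. \<Sum>y<M - Suc i. g y) = (\<Sum>x<M. \<Sum>y<x. g y)"
    by (rule sum.nat_diff_reindex)
  finally show ?thesis by (simp add: g_def)
qed

text \<open>Only the moved bead changes its term in \<open>sum_contents_beads\<close>, so the strip
  has \<open>t\<close> consecutive contents. The function \<open>f\<close> is arbitrary because the
  constant 1 yields the size and the square restricted to a residue class yields the sum of the
  theorem.\<close>

lemma sum_contents_add_hook:
  fixes f :: "int \<Rightarrow> 'a::ab_group_add"
  assumes p: "is_partition \<mu>" "is_partition \<nu>" and M: "length \<mu> \<le> M" "length \<nu> \<le> M"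
    and x: "x \<in> beads M \<mu>" "x + t \<notin> beads M \<mu>" and \<nu>: "beads M \<nu> = insert (x + t) (beads M \<mu> - {x})"
  shows "(\<Sum>b\<in>young \<nu>. f (box_content b)) =
    (\<Sum>b\<in>young \<mu>. f (box_content b)) + (\<Sum>y\<in>{x..<x + t}. f (int y + 1 - int M))"
proof -
  define \<Phi> where "\<Phi> x = (\<Sum>y<x. f (int y + 1 - int M))" for x
  have "(\<Sum>y\<in>beads M \<nu>. \<Phi> y) = \<Phi> (x + t) + (\<Sum>y\<in>beads M \<mu> - {x}. \<Phi> y)"
    unfolding \<nu> using x by (subst sum.insert) auto
  also have "\<dots> = \<Phi> (x + t) + ((\<Sum>y\<in>beads M \<mu>. \<Phi> y) - \<Phi> x)"
    using x by (simp add: sum_diff1)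
  also have "\<Phi> (x + t) = \<Phi> x + (\<Sum>y\<in>{x..<x + t}. f (int y + 1 - int M))"
    unfolding \<Phi>_def by (subst sum.union_disjoint[symmetric]) (auto intro!: sum.cong)
  finally show ?thesis
    using sum_contents_beads[OF p(1) M(1), of f] sum_contents_beads[OF p(2) M(2), of f]
    by (simp add: \<Phi>_def)
qed

lemma add_hook_size:
  assumes "add_hook t \<mu> \<nu>"
  shows "sum_list \<nu> = sum_list \<mu> + t"
proof -
  define M where "M = max (length \<mu> + t) (length \<nu>)"
  have p: "is_partition \<mu>" "is_partition \<nu>" using assms by (auto simp: add_hook_def)
  have M: "length \<mu> + t \<le> M" "length \<mu> \<le> M" "length \<nu> \<le> M" by (auto simp: M_def)
  obtain x where "x \<in> beads M \<mu>" "x + t \<notin> beads M \<mu>" "beads M \<nu> = insert (x + t) (beads M \<mu> - {x})"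
    using add_hook_imp_beads[OF assms M(1,3)] by blast
  from sum_contents_add_hook[OF p M(2,3) this, of "\<lambda>_. 1 :: int"]
  show ?thesis by (simp add: card_young flip: of_nat_add del: of_nat_add)
qed

lemma length_le_sum_list: "is_partition \<mu> \<Longrightarrow> length \<mu> \<le> sum_list \<mu>"
proof -
  have "0 \<notin> set \<mu> \<Longrightarrow> length \<mu> \<le> sum_list \<mu>" by (induction \<mu>) auto
  then show "is_partition \<mu> \<Longrightarrow> length \<mu> \<le> sum_list \<mu>" by (simp add: is_partition_def)
qed

section \<open>Runners, cores and hook additions\<close>

lemma down_closed_eq_lessThan:
  fixes S :: "nat set"
  assumes "finite S" and down: "\<And>m. Suc m \<in> S \<Longrightarrow> m \<in> S"
  shows "S = {..<card S}"
proof (cases "S = {}")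
  case False
  have "i \<in> S" if "i \<le> Max S" for i
    using that by (induction i rule: inc_induct) (use Max_in[OF assms(1) False] down in auto)
  then have "S = {..Max S}" using assms(1) by auto
  then show ?thesis by (metis card_atMost lessThan_Suc_atMost)
qed auto

definition runner :: "nat \<Rightarrow> nat \<Rightarrow> nat set \<Rightarrow> nat set" where
  "runner t r X = {m. t * m + r \<in> X}"

lemma finite_runner: "0 < t \<Longrightarrow> finite X \<Longrightarrow> finite (runner t r X)"
proof -
  assume "0 < t" "finite X"
  moreover have "runner t r X = (\<lambda>m. t * m + r) -` X" by (auto simp: runner_def)
  ultimately show ?thesis by (auto intro!: finite_vimageI simp: inj_def)
qed

lemma mem_runner_div_mod: "x div t \<in> runner t (x mod t) X \<longleftrightarrow> x \<in> X"
  by (simp add: runner_def)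

lemma runners_eqD: "0 < t \<Longrightarrow> (\<And>r. r < t \<Longrightarrow> runner t r X = runner t r Y) \<Longrightarrow> X = Y"
proof -
  assume "0 < t" and eq: "\<And>r. r < t \<Longrightarrow> runner t r X = runner t r Y"
  then have "x \<in> X \<longleftrightarrow> x \<in> Y" for x
    using eq[of "x mod t"] mem_runner_div_mod[of x t X] mem_runner_div_mod[of x t Y] by simp
  then show ?thesis by blast
qed

lemma sum_runners:
  fixes f :: "nat \<Rightarrow> 'a::comm_monoid_add"
  assumes "0 < t" "finite X"
  shows "(\<Sum>x\<in>X. f x) = (\<Sum>r<t. \<Sum>m\<in>runner t r X. f (t * m + r))"
proof -
  have "(\<Sum>r<t. \<Sum>m\<in>runner t r X. f (t * m + r)) =
      (\<Sum>(r, m)\<in>Sigma {..<t} (\<lambda>r. runner t r X). f (t * m + r))"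
    using assms by (subst sum.Sigma) (auto simp: finite_runner)
  also have "\<dots> = (\<Sum>x\<in>X. f x)"
    using assms(1)
    by (intro sum.reindex_bij_witness[of _ "\<lambda>x. (x mod t, x div t)" "\<lambda>(r, m). t * m + r"])
       (auto simp: runner_def)
  finally show ?thesis by simp
qed

lemma card_runner_move:
  assumes t: "0 < t" and r: "r < t" and fin: "finite X" and x: "x \<in> X" "x + t \<notin> X"
  shows "card (runner t r (insert (x + t) (X - {x}))) = card (runner t r X)"
proof (cases "x mod t = r")
  case False
  have "t * m + r \<noteq> x" "t * m + r \<noteq> x + t" for m
    using False r by (metis mod_mult_self4 mod_less, metis mod_mult_self4 mod_less mod_add_self2)
  then have "runner t r (insert (x + t) (X - {x})) = runner t r X" by (auto simp: runner_def)
  then show ?thesis by simp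
next
  case True
  define m where "m = x div t"
  have xm: "x = t * m + r" using True by (auto simp: m_def)
  have "x + t = t * Suc m + r" using xm by simp
  moreover have "t * a + r = t * b + r \<longleftrightarrow> a = b" for a b using t by simp
  ultimately have "runner t r (insert (x + t) (X - {x})) = insert (Suc m) (runner t r X - {m})"
    using xm by (auto simp: runner_def simp del: mult_Suc_right)
  moreover have "m \<in> runner t r X" "Suc m \<notin> runner t r X"
    using x xm by (auto simp: runner_def ac_simps)
  moreover have "finite (runner t r X)" using finite_runner t fin by blast
  ultimately show ?thesis by (simp add: card_gt_0_iff) (metis Suc_pred card_gt_0_iff empty_iff)
qed

section \<open>The order by hook additions, and cores\<close>

lemma hook_ge_induct [consumes 1, case_names refl step]:
  assumes "hook_ge t \<nu> \<mu>" "P \<mu>" "\<And>\<rho> \<nu>. hook_ge t \<rho> \<mu> \<Longrightarrow> P \<rho> \<Longrightarrow> add_hook t \<rho> \<nu> \<Longrightarrow> P \<nu>"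
  shows "P \<nu>"
  using assms(1) unfolding hook_ge_def
  by (induction rule: rtranclp_induct) (use assms(2,3) in \<open>unfold hook_ge_def, blast+\<close>)

lemma hook_ge_trans: "hook_ge t \<rho> \<mu> \<Longrightarrow> hook_ge t \<nu> \<rho> \<Longrightarrow> hook_ge t \<nu> \<mu>"
  by (simp add: hook_ge_def)

lemma hook_ge_refl [simp]: "hook_ge t \<mu> \<mu>"
  by (simp add: hook_ge_def)

lemma add_hook_hook_ge: "add_hook t \<mu> \<nu> \<Longrightarrow> hook_ge t \<nu> \<mu>"
  by (simp add: hook_ge_def r_into_rtranclp)

lemma hook_ge_size_le: "hook_ge t \<nu> \<mu> \<Longrightarrow> sum_list \<mu> \<le> sum_list \<nu>"
  by (induction rule: hook_ge_induct) (auto dest: add_hook_size)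

lemma hook_ge_partition: "hook_ge t \<nu> \<mu> \<Longrightarrow> is_partition \<nu> \<longleftrightarrow> is_partition \<mu>"
  by (induction rule: hook_ge_induct) (auto simp: add_hook_def)

lemma is_partition_Nil [simp]: "is_partition []"
  by (simp add: is_partition_def)

text \<open>A bound on the size dominates both length bounds, so one \<open>M\<close> serves for a
  whole chain of hook additions.\<close>

lemma add_hookE_beads:
  assumes "add_hook t \<mu> \<nu>" "sum_list \<nu> \<le> M"
  obtains x where "x \<in> beads M \<mu>" "x + t \<notin> beads M \<mu>" "beads M \<nu> = insert (x + t) (beads M \<mu> - {x})"
proof -
  have "length \<mu> + t \<le> M" "length \<nu> \<le> M"
    using assms add_hook_size[OF assms(1)] length_le_sum_list[of \<mu>] length_le_sum_list[of \<nu>]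
    by (auto simp: add_hook_def)
  then show ?thesis using add_hook_imp_beads[OF assms(1)] that by blast
qed

lemma hook_ge_card_runner:
  assumes "hook_ge t \<nu> \<mu>" "sum_list \<nu> \<le> M" "r < t"
  shows "card (runner t r (beads M \<nu>)) = card (runner t r (beads M \<mu>))"
  using assms
proof (induction rule: hook_ge_induct)
  case (step \<rho> \<nu>)
  obtain x where x: "x \<in> beads M \<rho>" "x + t \<notin> beads M \<rho>" "beads M \<nu> = insert (x + t) (beads M \<rho> - {x})"
    using add_hookE_beads[OF step.hyps(2) step.prems(1)] by blast
  have "sum_list \<rho> \<le> M" using add_hook_size[OF step.hyps(2)] step.prems(1) by simp
  then show ?case
    using step.IH step.prems(2) card_runner_move[OF _ step.prems(2) _ x(1,2)] x(3) by simp
qed auto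

text \<open>Otherwise the bead could slide back from \<open>x + t\<close> to \<open>x\<close>; the
  new set is again the bead set of a partition, and a hook would have been removed.\<close>

lemma core_beads_down:
  assumes core: "\<nexists>\<rho>. add_hook t \<rho> \<kappa>" and p: "is_partition \<kappa>" "length \<kappa> \<le> M"
    and x: "x + t \<in> beads M \<kappa>"
  shows "x \<in> beads M \<kappa>"
proof (rule ccontr)
  assume nx: "x \<notin> beads M \<kappa>"
  have c: "card (insert x (beads M \<kappa> - {x + t})) = M"
    using nx x card_beads[OF p(1), of M] by (simp add: card_gt_0_iff) (metis Suc_pred card_gt_0_iff empty_iff finite_beads)
  then obtain \<rho> where \<rho>: "is_partition \<rho>" "length \<rho> \<le> M" "beads M \<rho> = insert x (beads M \<kappa> - {x + t})"
    using ex_partition_beads[OF _ c] by auto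
  have ne: "0 < t" using nx x by (cases "t = 0") auto
  have "beads M \<kappa> = insert (x + t) (beads M \<rho> - {x})" using \<rho>(3) x nx ne by auto
  then have "add_hook t \<rho> \<kappa>"
    using \<rho> ne p by (intro add_hookI_beads[of \<rho> \<kappa> M x]) auto
  with core show False by blast
qed

text \<open>The runners of a core are initial segments by \<open>core_beads_down\<close>, and their
  lengths are the bead counts of \<mu>, which hook moves preserve.\<close>

lemma core_unique:
  assumes t: "0 < t" and "is_partition \<mu>"
    and \<kappa>: "hook_ge t \<mu> \<kappa>" "\<nexists>\<rho>. add_hook t \<rho> \<kappa>" and \<kappa>': "hook_ge t \<mu> \<kappa>'" "\<nexists>\<rho>. add_hook t \<rho> \<kappa>'"
  shows "\<kappa> = \<kappa>'"
proof -
  define M where "M = sum_list \<mu>"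
  have runner_eq: "runner t r (beads M \<kappa>) = {..<card (runner t r (beads M \<mu>))}"
    if "hook_ge t \<mu> \<kappa>" "\<nexists>\<rho>. add_hook t \<rho> \<kappa>" "r < t" for \<kappa> r
  proof -
    have "is_partition \<kappa>" using hook_ge_partition[OF that(1)] assms by simp
    moreover from this have "length \<kappa> \<le> M"
      using length_le_sum_list[of \<kappa>] hook_ge_size_le[OF that(1)] by (simp add: M_def)
    ultimately have down: "x + t \<in> beads M \<kappa> \<Longrightarrow> x \<in> beads M \<kappa>" for x
      by (rule core_beads_down[OF that(2)])
    have "runner t r (beads M \<kappa>) = {..<card (runner t r (beads M \<kappa>))}"
    proof (rule down_closed_eq_lessThan)
      fix m assume "Suc m \<in> runner t r (beads M \<kappa>)"
      then show "m \<in> runner t r (beads M \<kappa>)" using down[of "t * m + r"] by (simp add: runner_def ac_simps)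
    qed (simp add: finite_runner t)
    then show ?thesis using hook_ge_card_runner[OF that(1) _ that(3), of M] by (simp add: M_def)
  qed
  have "beads M \<kappa> = beads M \<kappa>'"
    using t by (rule runners_eqD) (simp add: runner_eq \<kappa> \<kappa>')
  moreover have "is_partition \<kappa>" "is_partition \<kappa>'"
    using hook_ge_partition \<kappa>(1) \<kappa>'(1) assms by blast+
  moreover have "length \<kappa> \<le> M" "length \<kappa>' \<le> M"
    using length_le_sum_list[of \<kappa>] length_le_sum_list[of \<kappa>'] calculation
      hook_ge_size_le[OF \<kappa>(1)] hook_ge_size_le[OF \<kappa>'(1)] by (simp_all add: M_def)
  ultimately show ?thesis using beads_inject by blast
qed

lemma core_exists:
  assumes t: "0 < t"
  shows "\<exists>\<kappa>. hook_ge t \<mu> \<kappa> \<and> (\<nexists>\<rho>. add_hook t \<rho> \<kappa>)"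
proof (induction "sum_list \<mu>" arbitrary: \<mu> rule: less_induct)
  case less
  show ?case
  proof (cases "\<exists>\<rho>. add_hook t \<rho> \<mu>")
    case True
    then obtain \<rho> where \<rho>: "add_hook t \<rho> \<mu>" by blast
    then have "sum_list \<rho> < sum_list \<mu>" using add_hook_size t by fastforce
    then obtain \<kappa> where "hook_ge t \<rho> \<kappa>" "\<nexists>\<rho>. add_hook t \<rho> \<kappa>" using less by blast
    then show ?thesis using hook_ge_trans add_hook_hook_ge[OF \<rho>] by blast
  qed (use hook_ge_refl in blast)
qed

text \<open>No hook can be removed from the empty partition, so it is the core of everything built
  from it.\<close>

lemma t_core_eq_Nil_iff:
  assumes t: "0 < t" and p: "is_partition \<mu>"
  shows "t_core t \<mu> = [] \<longleftrightarrow> hook_ge t \<mu> []"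
proof -
  have Nil: "\<nexists>\<rho>. add_hook t \<rho> []" using t add_hook_size by fastforce
  have "\<exists>!\<kappa>. hook_ge t \<mu> \<kappa> \<and> (\<nexists>\<rho>. add_hook t \<rho> \<kappa>)"
    using core_exists[OF t] core_unique[OF t p] by blast
  from theI'[OF this] have "hook_ge t \<mu> (t_core t \<mu>)" "\<nexists>\<rho>. add_hook t \<rho> (t_core t \<mu>)"
    by (simp_all add: t_core_def)
  then show ?thesis using core_unique[OF t p] Nil by metis
qed

text \<open>Each step adds \<open>t\<close> to the size, which leaves room for a single step. This
  turns the summation range of \<open>F_skew\<close> into single hook additions.\<close>

lemma hook_ge_size_step:
  assumes t: "0 < t" and size: "sum_list \<nu> = sum_list \<rho> + t"
  shows "hook_ge t \<nu> \<rho> \<longleftrightarrow> add_hook t \<rho> \<nu>"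
proof
  have eq: "\<sigma> = \<rho>" if "hook_ge t \<sigma> \<rho>" "sum_list \<sigma> = sum_list \<rho>" for \<sigma>
    using that(1)[unfolded hook_ge_def]
  proof (cases rule: rtranclp.cases)
    case (rtrancl_into_rtrancl \<tau>)
    then show ?thesis using that hook_ge_size_le[of t \<tau> \<rho>] add_hook_size[of t \<tau> \<sigma>] t
      by (simp add: hook_ge_def)
  qed simp
  assume "hook_ge t \<nu> \<rho>"
  then show "add_hook t \<rho> \<nu>"
    unfolding hook_ge_def
  proof (cases rule: rtranclp.cases)
    case (rtrancl_into_rtrancl \<sigma>)
    then show ?thesis using eq[of \<sigma>] add_hook_size[of t \<sigma> \<nu>] size by (simp add: hook_ge_def)
  qed (use size t in simp)
qed (rule add_hook_hook_ge)

section \<open>Partitions with empty core and the recursion for F\<close>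

lemma finite_partitions: "finite {\<mu>. is_partition \<mu> \<and> sum_list \<mu> = s}"
proof (rule finite_subset)
  show "{\<mu>. is_partition \<mu> \<and> sum_list \<mu> = s} \<subseteq> {\<mu>. set \<mu> \<subseteq> {..s} \<and> length \<mu> \<le> s}"
    using length_le_sum_list by (auto intro: member_le_sum_list)
qed (rule finite_lists_length_le, simp)

text \<open>Reachability from the empty partition replaces the condition on \<open>t_core\<close>,
  so that closure under hook additions is just transitivity.\<close>

definition empty_core_partitions :: "nat \<Rightarrow> nat \<Rightarrow> nat list set" where
  "empty_core_partitions t n = {\<mu>. hook_ge t \<mu> [] \<and> sum_list \<mu> = n * t}"

lemma empty_core_partitions_eq:
  "0 < t \<Longrightarrow> {\<mu>. is_partition \<mu> \<and> t_core t \<mu> = [] \<and> sum_list \<mu> = n * t} = empty_core_partitions t n"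
proof -
  assume t: "0 < t"
  have "is_partition \<mu> \<and> t_core t \<mu> = [] \<longleftrightarrow> hook_ge t \<mu> []" for \<mu>
    using t_core_eq_Nil_iff[OF t, of \<mu>] hook_ge_partition[of t \<mu> "[]"] by auto
  then show ?thesis unfolding empty_core_partitions_def by blast
qed

lemma empty_core_partition: "\<mu> \<in> empty_core_partitions t n \<Longrightarrow> is_partition \<mu>"
  using hook_ge_partition[of t \<mu> "[]"] by (simp add: empty_core_partitions_def)

lemma empty_core_partitions_0: "empty_core_partitions t 0 = {[]}"
proof -
  have "\<mu> = []" if "is_partition \<mu>" "sum_list \<mu> = 0" for \<mu>
    using length_le_sum_list[OF that(1)] that(2) by simp
  then have "\<mu> = []" if "\<mu> \<in> empty_core_partitions t 0" for \<mu>
    using that empty_core_partition[OF that] by (simp add: empty_core_partitions_def)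
  moreover have "[] \<in> empty_core_partitions t 0" by (simp add: empty_core_partitions_def)
  ultimately show ?thesis by blast
qed

lemma finite_empty_core_partitions [simp]: "finite (empty_core_partitions t n)"
proof (rule finite_subset[OF _ finite_partitions[of "n * t"]])
  show "empty_core_partitions t n \<subseteq> {\<mu>. is_partition \<mu> \<and> sum_list \<mu> = n * t}"
    using empty_core_partition by (auto simp: empty_core_partitions_def)
qed

lemma finite_add_hook [simp]: "finite {\<nu>. add_hook t \<mu> \<nu>}"
proof (rule finite_subset[OF _ finite_partitions[of "sum_list \<mu> + t"]])
  show "{\<nu>. add_hook t \<mu> \<nu>} \<subseteq> {\<nu>. is_partition \<nu> \<and> sum_list \<nu> = sum_list \<mu> + t}"
    using add_hook_size by (auto simp: add_hook_def)
qed

lemma F_skew_empty_core_Suc: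
  assumes t: "0 < t" and \<nu>: "\<nu> \<in> empty_core_partitions t (Suc n)"
  shows "F_skew t \<nu> [] = (\<Sum>\<rho>\<in>{\<rho> \<in> empty_core_partitions t n. add_hook t \<rho> \<nu>}. F_skew t \<rho> [])"
proof -
  have "\<nu> \<noteq> []" using \<nu> t by (auto simp: empty_core_partitions_def)
  moreover have "{\<rho>. 0 < t \<and> hook_ge t \<nu> \<rho> \<and> hook_ge t \<rho> [] \<and> sum_list \<nu> = sum_list \<rho> + t} =
      {\<rho> \<in> empty_core_partitions t n. add_hook t \<rho> \<nu>}"
    using \<nu> t hook_ge_size_step[OF t] add_hook_size[of t]
    by (fastforce simp: empty_core_partitions_def)
  ultimately show ?thesis by (subst F_skew.simps) simp
qed

text \<open>Interchanging the sums trades removals for additions. The inner sum is unrestricted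
  because every hook added to a partition with empty core gives another one.\<close>

lemma sum_F_skew_Suc:
  fixes g :: "nat list \<Rightarrow> real"
  assumes t: "0 < t"
  shows "(\<Sum>\<nu>\<in>empty_core_partitions t (Suc n). F_skew t \<nu> [] * g \<nu>) =
    (\<Sum>\<mu>\<in>empty_core_partitions t n. F_skew t \<mu> [] * (\<Sum>\<nu>\<in>{\<nu>. add_hook t \<mu> \<nu>}. g \<nu>))"
proof -
  let ?F = "\<lambda>\<mu>. real (F_skew t \<mu> [])"
  have "(\<Sum>\<nu>\<in>empty_core_partitions t (Suc n). ?F \<nu> * g \<nu>) =
      (\<Sum>\<nu>\<in>empty_core_partitions t (Suc n). \<Sum>\<mu> | \<mu> \<in> empty_core_partitions t n \<and> add_hook t \<mu> \<nu>. ?F \<mu> * g \<nu>)"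
    by (simp add: F_skew_empty_core_Suc[OF t] sum_distrib_right)
  also have "\<dots> = (\<Sum>\<mu>\<in>empty_core_partitions t n. \<Sum>\<nu> | \<nu> \<in> empty_core_partitions t (Suc n) \<and> add_hook t \<mu> \<nu>. ?F \<mu> * g \<nu>)"
    by (rule sum.swap_restrict) simp_all
  also have "\<dots> = (\<Sum>\<mu>\<in>empty_core_partitions t n. ?F \<mu> * (\<Sum>\<nu>\<in>{\<nu>. add_hook t \<mu> \<nu>}. g \<nu>))"
  proof (rule sum.cong[OF refl])
    fix \<mu> assume \<mu>: "\<mu> \<in> empty_core_partitions t n"
    then have "{\<nu>. \<nu> \<in> empty_core_partitions t (Suc n) \<and> add_hook t \<mu> \<nu>} = {\<nu>. add_hook t \<mu> \<nu>}"
      using add_hook_size hook_ge_trans add_hook_hook_ge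
      by (fastforce simp: empty_core_partitions_def)
    then show "(\<Sum>\<nu> | \<nu> \<in> empty_core_partitions t (Suc n) \<and> add_hook t \<mu> \<nu>. ?F \<mu> * g \<nu>) =
        ?F \<mu> * (\<Sum>\<nu>\<in>{\<nu>. add_hook t \<mu> \<nu>}. g \<nu>)"
      by (simp add: sum_distrib_left)
  qed
  finally show ?thesis .
qed

section \<open>Hook products\<close>

definition col_len :: "nat list \<Rightarrow> nat \<Rightarrow> nat" where
  "col_len \<mu> j = card {i. j < row_len \<mu> i}"

lemma less_col_len_iff:
  assumes p: "is_partition \<mu>"
  shows "i < col_len \<mu> j \<longleftrightarrow> j < row_len \<mu> i"
proof -
  have "{i. j < row_len \<mu> i} = {..<col_len \<mu> j}"
    unfolding col_len_def
  proof (rule down_closed_eq_lessThan)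
    show "finite {i. j < row_len \<mu> i}"
      by (rule finite_subset[of _ "{..<length \<mu>}"]) (auto simp: row_len_def split: if_splits)
    show "m \<in> {i. j < row_len \<mu> i}" if "Suc m \<in> {i. j < row_len \<mu> i}" for m
      using that row_antimono[OF p, of m "Suc m"] by simp
  qed
  then show ?thesis by auto
qed

text \<open>The position, among the non-beads, of the horizontal boundary edge of column \<open>j\<close>.\<close>

definition gap :: "nat \<Rightarrow> nat list \<Rightarrow> nat \<Rightarrow> nat" where
  "gap M \<mu> j = j + (M - col_len \<mu> j)"

text \<open>Arm plus leg plus one is \<open>row_len \<mu> i - j + col_len \<mu> j - i - 1\<close>,
  and the shift by \<open>M\<close> cancels in the difference of bead and gap. The bound on the
  length keeps \<open>M - col_len \<mu> j\<close> from truncating.\<close>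

lemma hook_length_gap:
  assumes p: "is_partition \<mu>" and M: "length \<mu> \<le> M" and i: "i < M" and j: "j < row_len \<mu> i"
  shows "gap M \<mu> j < bead M \<mu> i" and "hook_length \<mu> (i, j) = bead M \<mu> i - gap M \<mu> j"
proof -
  have c: "i < col_len \<mu> j" using j by (simp add: less_col_len_iff[OF p])
  have "\<not> M < col_len \<mu> j" using M by (simp add: less_col_len_iff[OF p] row_len_eq_0)
  then have cM: "col_len \<mu> j \<le> M" by simp
  have arm: "{j'. j < j' \<and> (i, j') \<in> young \<mu>} = {j<..<row_len \<mu> i}"
    by (auto simp: young_iff_row)
  have leg: "{i'. i < i' \<and> (i', j) \<in> young \<mu>} = {i<..<col_len \<mu> j}"
    by (auto simp: young_iff_row less_col_len_iff[OF p])
  show "gap M \<mu> j < bead M \<mu> i" using c cM i j by (simp add: gap_def bead_def)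
  show "hook_length \<mu> (i, j) = bead M \<mu> i - gap M \<mu> j"
    unfolding hook_length.simps arm leg using c cM i j by (simp add: gap_def bead_def)
qed

lemma gap_less:
  assumes p: "is_partition \<mu>" and "j < j'"
  shows "gap M \<mu> j < gap M \<mu> j'"
proof -
  have "col_len \<mu> j' \<le> col_len \<mu> j"
    using less_col_len_iff[OF p] assms(2) by (metis le_eq_less_or_eq linorder_not_less order.strict_trans)
  then show ?thesis using assms(2) by (simp add: gap_def)
qed

lemma gap_notin_beads:
  assumes p: "is_partition \<mu>" and M: "length \<mu> \<le> M"
  shows "gap M \<mu> j \<notin> beads M \<mu>"
proof
  assume "gap M \<mu> j \<in> beads M \<mu>"
  then obtain i where i: "i < M" "gap M \<mu> j = bead M \<mu> i" by (auto simp: beads_def)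
  have "\<not> M < col_len \<mu> j" using M by (simp add: less_col_len_iff[OF p] row_len_eq_0)
  then show False
    using i less_col_len_iff[OF p, of i j] by (cases "i < col_len \<mu> j") (auto simp: gap_def bead_def)
qed

text \<open>Inclusion and a count: among the sites below the bead of row \<open>i\<close>, exactly
  the \<open>M - Suc i\<close> beads of the later rows are occupied, which leaves
  \<open>row_len \<mu> i\<close> free sites.\<close>

lemma gap_image:
  assumes p: "is_partition \<mu>" and M: "length \<mu> \<le> M" and i: "i < M"
  shows "gap M \<mu> ` {..<row_len \<mu> i} = {..<bead M \<mu> i} - beads M \<mu>"
proof (rule card_subset_eq)
  show "gap M \<mu> ` {..<row_len \<mu> i} \<subseteq> {..<bead M \<mu> i} - beads M \<mu>"
    using gap_notin_beads[OF p M] hook_length_gap(1)[OF p M i] by auto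
  have "inj_on (gap M \<mu>) {..<row_len \<mu> i}"
    by (rule inj_onI) (metis gap_less[OF p] less_irrefl linorder_less_linear)
  then have "card (gap M \<mu> ` {..<row_len \<mu> i}) = row_len \<mu> i" by (simp add: card_image)
  moreover have "card ({..<bead M \<mu> i} - beads M \<mu>) = row_len \<mu> i"
  proof -
    have "bead M \<mu> j < bead M \<mu> i \<longleftrightarrow> i < j" if "j < M" for j
      using bead_less[OF p, of i j M] bead_less[OF p, of j i M] that i by (cases i j rule: linorder_cases) auto
    then have "beads M \<mu> \<inter> {..<bead M \<mu> i} = bead M \<mu> ` {i<..<M}"
      unfolding beads_def by auto
    moreover have "inj_on (bead M \<mu>) {i<..<M}"
      using inj_on_bead[OF p] by (rule inj_on_subset) auto
    ultimately have "card ({..<bead M \<mu> i} \<inter> beads M \<mu>) = M - Suc i"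
      by (simp add: card_image Int_commute)
    then show ?thesis by (simp add: card_Diff_subset_Int bead_def)
  qed
  ultimately show "card (gap M \<mu> ` {..<row_len \<mu> i}) = card ({..<bead M \<mu> i} - beads M \<mu>)" by simp
qed simp

section \<open>Products of the hooks divisible by t, and how they change when a bead moves\<close>

definition dvd_part :: "nat \<Rightarrow> nat \<Rightarrow> nat" where
  "dvd_part t h = (if t dvd h then h else 1)"

definition hook_prod :: "nat \<Rightarrow> nat set \<Rightarrow> nat" where
  "hook_prod t X = (\<Prod>x\<in>X. \<Prod>y\<in>{..<x} - X. dvd_part t (x - y))"

lemma G_hook_beads:
  assumes p: "is_partition \<mu>" and M: "length \<mu> \<le> M"
  shows "G_hook t \<mu> = 1 / hook_prod t (beads M \<mu>)"
proof -
  have row: "(\<Prod>j<row_len \<mu> i. dvd_part t (hook_length \<mu> (i, j))) =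
      (\<Prod>y\<in>{..<bead M \<mu> i} - beads M \<mu>. dvd_part t (bead M \<mu> i - y))" if i: "i < M" for i
  proof -
    have "inj_on (gap M \<mu>) {..<row_len \<mu> i}"
      by (rule inj_onI) (metis gap_less[OF p] less_irrefl linorder_less_linear)
    then show ?thesis
      unfolding gap_image[OF p M i, symmetric]
      by (simp add: prod.reindex hook_length_gap(2)[OF p M i] del: hook_length.simps)
  qed
  have "(\<Prod>h \<in># filter_mset (\<lambda>h. t dvd h) (hook_lengths \<mu>). h) =
      (\<Prod>b\<in>{b \<in> young \<mu>. t dvd hook_length \<mu> b}. hook_length \<mu> b)"
    by (simp add: hook_lengths_def filter_mset_image_mset prod_unfold_prod_mset)
  also have "\<dots> = (\<Prod>b\<in>young \<mu>. dvd_part t (hook_length \<mu> b))"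
    unfolding dvd_part_def by (rule prod.inter_filter) simp
  also have "\<dots> = (\<Prod>i<M. \<Prod>j<row_len \<mu> i. dvd_part t (hook_length \<mu> (i, j)))"
    by (subst young_Sigma[OF M], subst prod.Sigma) (auto intro!: prod.cong)
  also have "\<dots> = hook_prod t (beads M \<mu>)"
    unfolding hook_prod_def
    by (simp add: row beads_def prod.reindex[OF inj_on_bead[OF p]] del: hook_length.simps)
  finally show ?thesis by (simp add: G_hook_def)
qed

lemma dvd_part_pos: "0 < h \<Longrightarrow> 0 < dvd_part t h"
  by (simp add: dvd_part_def)

lemma hook_prod_pos: "finite X \<Longrightarrow> 0 < hook_prod t X"
  unfolding hook_prod_def by (intro prod_pos ballI dvd_part_pos) auto

text \<open>The part divisible by \<open>t\<close> of the Vandermonde product. It refers to beads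
  only, whereas the non-beads in \<open>hook_prod\<close> change along with the beads.\<close>

definition bead_diff_prod :: "nat \<Rightarrow> nat set \<Rightarrow> nat" where
  "bead_diff_prod t X = (\<Prod>x\<in>X. \<Prod>y\<in>{..<x} \<inter> X. dvd_part t (x - y))"

text \<open>The product of the multiples of \<open>t\<close> in x!, that is, t^q * q! with q =
  \<open>x div t\<close> when \<open>t\<close> is positive.\<close>

definition t_fact :: "nat \<Rightarrow> nat \<Rightarrow> nat" where
  "t_fact t x = (\<Prod>d\<in>{1..x}. dvd_part t d)"

lemma t_fact_pos: "0 < t_fact t x"
  unfolding t_fact_def by (intro prod_pos ballI dvd_part_pos) auto

lemma bead_diff_prod_pos: "finite X \<Longrightarrow> 0 < bead_diff_prod t X"
  unfolding bead_diff_prod_def by (intro prod_pos ballI dvd_part_pos) auto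

text \<open>The distances from a bead to the smaller non-beads are its hooks, those to the smaller beads are the
  bead differences; together they are \<open>1, \<dots>, x\<close>.\<close>

lemma hook_prod_mult_bead_diff_prod: "hook_prod t X * bead_diff_prod t X = (\<Prod>x\<in>X. t_fact t x)"
proof -
  have "t_fact t x = (\<Prod>y\<in>{..<x} - X. dvd_part t (x - y)) * (\<Prod>y\<in>{..<x} \<inter> X. dvd_part t (x - y))" for x
  proof -
    have "t_fact t x = (\<Prod>y<x. dvd_part t (x - y))"
      unfolding t_fact_def by (rule prod.reindex_bij_witness[of _ "\<lambda>y. x - y" "\<lambda>d. x - d"]) auto
    also have "\<dots> = (\<Prod>y\<in>({..<x} - X) \<union> ({..<x} \<inter> X). dvd_part t (x - y))"
      by (rule prod.cong) auto
    also have "\<dots> = (\<Prod>y\<in>{..<x} - X. dvd_part t (x - y)) * (\<Prod>y\<in>{..<x} \<inter> X. dvd_part t (x - y))"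
      by (rule prod.union_disjoint) auto
    finally show ?thesis .
  qed
  then show ?thesis by (simp add: hook_prod_def bead_diff_prod_def prod.distrib)
qed

text \<open>Exactly one of the \<open>t\<close> consecutive new factors is a multiple of
  \<open>t\<close>.\<close>

lemma t_fact_add:
  assumes t: "0 < t"
  shows "t_fact t (x + t) = t_fact t x * (t * (x div t + 1))"
proof -
  have "t_fact t (x + t) = t_fact t x * (\<Prod>d\<in>{x<..x + t}. dvd_part t d)"
    unfolding t_fact_def by (subst prod.union_disjoint[symmetric]) (auto intro!: prod.cong)
  also have "(\<Prod>d\<in>{x<..x + t}. dvd_part t d) = (\<Prod>d\<in>{t * (x div t + 1)}. dvd_part t d)"
  proof (rule prod.mono_neutral_right)
    have "t * (x div t) \<le> x" "x < t * (x div t) + t"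
      using mod_less_divisor[OF t, of x] mult_div_mod_eq[of t x] by linarith+
    then show "{t * (x div t + 1)} \<subseteq> {x<..x + t}" by simp
    show "\<forall>d\<in>{x<..x + t} - {t * (x div t + 1)}. dvd_part t d = 1"
    proof
      fix d assume d: "d \<in> {x<..x + t} - {t * (x div t + 1)}"
      have "\<not> t dvd d"
      proof
        assume "t dvd d"
        then obtain m where m: "d = t * m" by blast
        then have "x < t * m" "t * m \<le> x + t" using d by auto
        then have "t * (x div t) < t * m" "t * m < t * (x div t + 2)"
          unfolding distrib_left
          using \<open>t * (x div t) \<le> x\<close> \<open>x < t * (x div t) + t\<close> by linarith+
        then have "x div t < m" "m < x div t + 2"
          using nat_mult_less_cancel_disj[of t] by blast+
        then have "m = x div t + 1" by simp
        with d m show False by simp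
      qed
      then show "dvd_part t d = 1" by (simp add: dvd_part_def)
    qed
  qed simp
  finally show ?thesis by (simp add: dvd_part_def)
qed

text \<open>The new bead is the larger one in some pairs and the smaller one in others; the absolute
  difference merges both cases, so the same expression serves for the old and the new place of a
  moved bead.\<close>

lemma bead_diff_prod_insert:
  assumes fin: "finite Z" and a: "a \<notin> Z"
  shows "bead_diff_prod t (insert a Z) = bead_diff_prod t Z * (\<Prod>z\<in>Z. dvd_part t (nat \<bar>int a - int z\<bar>))"
proof -
  have "{..<a} \<inter> insert a Z = {z \<in> Z. z < a}" by auto
  then have new: "(\<Prod>y\<in>{..<a} \<inter> insert a Z. dvd_part t (a - y)) = (\<Prod>z\<in>Z. if z < a then dvd_part t (a - z) else 1)"
    by (simp add: prod.inter_filter[OF fin])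
  have old: "(\<Prod>y\<in>{..<z} \<inter> insert a Z. dvd_part t (z - y)) =
      (\<Prod>y\<in>{..<z} \<inter> Z. dvd_part t (z - y)) * (if a < z then dvd_part t (z - a) else 1)" for z
  proof (cases "a < z")
    case True
    then have "{..<z} \<inter> insert a Z = insert a ({..<z} \<inter> Z)" by auto
    then show ?thesis using a True by simp
  next
    case False
    then have "{..<z} \<inter> insert a Z = {..<z} \<inter> Z" by auto
    then show ?thesis using False by simp
  qed
  have "(if z < a then dvd_part t (a - z) else 1) * (if a < z then dvd_part t (z - a) else 1) =
      dvd_part t (nat \<bar>int a - int z\<bar>)" if "z \<in> Z" for z
    using that a by (cases a z rule: linorder_cases) (auto simp: nat_diff_distrib' of_nat_diff)
  then have "(\<Prod>z\<in>Z. if z < a then dvd_part t (a - z) else 1) * (\<Prod>z\<in>Z. if a < z then dvd_part t (z - a) else 1) =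
      (\<Prod>z\<in>Z. dvd_part t (nat \<bar>int a - int z\<bar>))"
    by (simp flip: prod.distrib)
  note pairs = this
  have "bead_diff_prod t (insert a Z) =
      (\<Prod>y\<in>{..<a} \<inter> insert a Z. dvd_part t (a - y)) * (\<Prod>z\<in>Z. \<Prod>y\<in>{..<z} \<inter> insert a Z. dvd_part t (z - y))"
    unfolding bead_diff_prod_def using fin a by (rule prod.insert)
  also have "\<dots> = (\<Prod>z\<in>Z. if z < a then dvd_part t (a - z) else 1) *
      (\<Prod>z\<in>Z. (\<Prod>y\<in>{..<z} \<inter> Z. dvd_part t (z - y)) * (if a < z then dvd_part t (z - a) else 1))"
    unfolding new by (simp only: old)
  also have "\<dots> = bead_diff_prod t Z * ((\<Prod>z\<in>Z. if z < a then dvd_part t (a - z) else 1) *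
      (\<Prod>z\<in>Z. if a < z then dvd_part t (z - a) else 1))"
    by (simp only: prod.distrib bead_diff_prod_def mult.commute mult.left_commute mult.assoc)
  finally show ?thesis unfolding pairs .
qed

text \<open>With \<open>Z\<close> the untouched beads, everything not involving the moved bead
  cancels. The restricted factorials leave \<open>1 / (t * (x div t + 1))\<close>, which supplies
  both the factor 1/t and the denominator of the transition weight.\<close>

lemma hook_prod_move:
  assumes t: "0 < t" and fin: "finite X" and x: "x \<in> X" "x + t \<notin> X"
  shows "hook_prod t X / hook_prod t (insert (x + t) (X - {x})) =
    transition_weight (real ` runner t (x mod t) X) (real (x div t)) / t"
proof -
  define Z where "Z = X - {x}"
  define r where "r = x mod t"
  define m where "m = x div t"
  define \<phi> where "\<phi> a z = real (dvd_part t (nat \<bar>int a - int z\<bar>))" for a z :: nat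
  have xm: "x = t * m + r" by (simp add: m_def r_def)
  have Z: "finite Z" "x \<notin> Z" "x + t \<notin> Z" and X: "X = insert x Z" using fin x by (auto simp: Z_def)
  let ?Y = "insert (x + t) Z"
  note pos = hook_prod_pos[of _ t] bead_diff_prod_pos[of _ t]
  have H: "real (hook_prod t W) = (\<Prod>w\<in>W. real (t_fact t w)) / real (bead_diff_prod t W)" if "finite W" for W
    using hook_prod_mult_bead_diff_prod[of t W] pos(2)[OF that]
    by (simp add: eq_divide_eq flip: of_nat_mult of_nat_prod)
  have D: "real (bead_diff_prod t (insert a Z)) = real (bead_diff_prod t Z) * (\<Prod>z\<in>Z. \<phi> a z)"
    if "a \<notin> Z" for a
    by (simp add: bead_diff_prod_insert[OF Z(1) that] \<phi>_def)
  have "(\<Prod>z\<in>Z. \<phi> a z) \<noteq> 0" if "a \<notin> Z" for a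
  proof -
    have "\<phi> a z \<noteq> 0" if "z \<in> Z" for z
      using \<open>a \<notin> Z\<close> that dvd_part_pos[of "nat \<bar>int a - int z\<bar>" t] by (cases "a = z") (auto simp: \<phi>_def)
    then show ?thesis using Z(1) by simp
  qed
  then have \<phi>0: "(\<Prod>z\<in>Z. \<phi> x z) \<noteq> 0" "(\<Prod>z\<in>Z. \<phi> (x + t) z) \<noteq> 0"
    using Z by blast+
  have T0: "(\<Prod>z\<in>Z. real (t_fact t z)) \<noteq> 0" "real (t_fact t x) \<noteq> 0" "real (bead_diff_prod t Z) \<noteq> 0"
    using Z(1) t_fact_pos[of t] bead_diff_prod_pos[OF Z(1), of t] by (auto simp: prod_zero_iff)
  have "hook_prod t X / hook_prod t ?Y =
      (\<Prod>z\<in>Z. \<phi> (x + t) z) / (\<Prod>z\<in>Z. \<phi> x z) / (t * (real m + 1))"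
    using Z T0 \<phi>0 t by (simp add: X H D t_fact_add[OF t] flip: m_def) (simp add: field_simps)
  also have "(\<Prod>z\<in>Z. \<phi> (x + t) z) / (\<Prod>z\<in>Z. \<phi> x z) = (\<Prod>z\<in>Z. \<phi> (x + t) z / \<phi> x z)"
    by (simp add: prod_dividef)
  \<comment> \<open>For a bead on another runner neither distance is divisible by \<open>t\<close>,
    so both values of \<phi> are 1.\<close>
  also have "\<dots> = (\<Prod>z\<in>(\<lambda>m'. t * m' + r) ` (runner t r X - {m}). \<phi> (x + t) z / \<phi> x z)"
  proof (rule prod.mono_neutral_right[OF Z(1)])
    show "(\<lambda>m'. t * m' + r) ` (runner t r X - {m}) \<subseteq> Z"
      using t by (auto simp: runner_def Z_def xm)
    show "\<forall>z\<in>Z - (\<lambda>m'. t * m' + r) ` (runner t r X - {m}). \<phi> (x + t) z / \<phi> x z = 1"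
    proof
      fix z assume z: "z \<in> Z - (\<lambda>m'. t * m' + r) ` (runner t r X - {m})"
      have "z mod t \<noteq> r"
      proof
        assume "z mod t = r"
        then have "z = t * (z div t) + r" by (metis mult_div_mod_eq)
        moreover have "z div t \<noteq> m" using calculation z xm Z by auto
        ultimately have "z \<in> (\<lambda>m'. t * m' + r) ` (runner t r X - {m})"
          using z by (intro image_eqI[of _ _ "z div t"]) (auto simp: runner_def Z_def)
        with z show False by blast
      qed
      have "\<not> int t dvd int x - int z"
      proof
        assume "int t dvd int x - int z"
        then have "int x mod int t = int z mod int t" by (simp add: mod_eq_dvd_iff)
        then show False using \<open>z mod t \<noteq> r\<close> r_def by (metis of_nat_eq_iff of_nat_mod)
      qed
      moreover from this have "\<not> int t dvd int (x + t) - int z"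
        by (metis add_diff_eq add.commute dvd_add_triv_left_iff of_nat_add)
      moreover have "t dvd nat \<bar>i\<bar> \<longleftrightarrow> int t dvd i" for i using int_dvd_int_iff[of t "nat \<bar>i\<bar>"] by simp
      ultimately show "\<phi> (x + t) z / \<phi> x z = 1" by (simp add: \<phi>_def dvd_part_def)
    qed
  qed
  also have "\<dots> = (\<Prod>m'\<in>runner t r X - {m}. \<phi> (x + t) (t * m' + r) / \<phi> x (t * m' + r))"
    using t by (subst prod.reindex) (auto simp: inj_on_def)
  also have "\<dots> = (\<Prod>m'\<in>runner t r X - {m}. (real m + 1 - real m') / (real m - real m'))"
  proof (rule prod.cong[OF refl])
    fix m' assume m': "m' \<in> runner t r X - {m}"
    have "m' \<noteq> Suc m" using m' x by (auto simp: runner_def xm ac_simps)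
    have \<phi>: "\<phi> (t * a + r) (t * b + r) = real t * \<bar>real a - real b\<bar>" for a b
    proof -
      have "int (t * a + r) - int (t * b + r) = int t * (int a - int b)" by (simp add: algebra_simps)
      then have "nat \<bar>int (t * a + r) - int (t * b + r)\<bar> = t * nat \<bar>int a - int b\<bar>"
        by (simp only: abs_mult) (simp add: nat_mult_distrib)
      then show ?thesis by (simp add: \<phi>_def dvd_part_def)
    qed
    have "\<phi> (x + t) (t * m' + r) = real t * \<bar>real m + 1 - real m'\<bar>"
      using \<phi>[of "Suc m" m'] by (simp add: xm ac_simps)
    moreover have "\<phi> x (t * m' + r) = real t * \<bar>real m - real m'\<bar>" unfolding xm by (rule \<phi>)
    \<comment> \<open>As m' is neither m nor m + 1, both differences have the same sign.\<close>
    moreover have "\<bar>real m + 1 - real m'\<bar> / \<bar>real m - real m'\<bar> = (real m + 1 - real m') / (real m - real m')"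
    proof (cases "m' < m")
      case False
      with m' \<open>m' \<noteq> Suc m\<close> have "real m' \<ge> real m + 2" by (simp add: nat_less_real_le)
      then show ?thesis by (simp add: abs_if divide_simps algebra_simps)
    qed (simp add: abs_if)
    ultimately show "\<phi> (x + t) (t * m' + r) / \<phi> x (t * m' + r) = (real m + 1 - real m') / (real m - real m')"
      using t by simp
  qed
  also have "\<dots> = (\<Prod>y\<in>real ` runner t r X - {real m}. (real m + 1 - y) / (real m - y))"
  proof -
    have "real ` runner t r X - {real m} = real ` (runner t r X - {m})" by auto
    then show ?thesis by (simp add: prod.reindex)
  qed
  finally show ?thesis by (simp add: transition_weight_def Z_def r_def m_def mult.commute)
qed

section \<open>Averaging over added hooks\<close>

text \<open>The factor with \<open>y = x + 1\<close> vanishes. Blocked beads thus weigh nothing, and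
  sums over movable beads extend to whole runners.\<close>

lemma transition_weight_eq_0:
  assumes "finite X" "x + 1 \<in> X"
  shows "transition_weight X x = 0"
proof -
  have "(\<Prod>y\<in>X - {x}. (x + 1 - y) / (x - y)) = 0"
    by (rule prod_zero) (use assms in auto)
  then show ?thesis by (simp add: transition_weight_def)
qed

text \<open>The mean of \<open>x\<close> is \<open>card X - 1\<close>, so the centred variable has
  mean 0 and no term linear in \<kappa> survives. Its second moment is the excess of \<Sum>X over 0
  + ... + (N - 1), for bead sets the size of the partition.\<close>

lemma transition_weight_square:
  assumes X: "finite X" "0 \<in> X" "- 1 \<notin> X" and t: "t \<noteq> 0"
  shows "(\<Sum>x\<in>X. transition_weight X x * (A + B * (t * (x + 1 - real (card X)) + \<kappa>)\<^sup>2)) =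
    A + B * (t\<^sup>2 * (\<Sum>X - real (card X) * (real (card X) - 1) / 2) + \<kappa>\<^sup>2)"
proof -
  define N where "N = real (card X)"
  define \<delta> where "\<delta> = t * (1 - N) + \<kappa>"
  \<comment> \<open>The bracket equals \<open>t * x + \<delta>\<close>; pulling out t^2 leaves the
    monic quadratic of \<open>transition_weight_quadratic\<close>.\<close>
  have eq: "A + B * (t * (x + 1 - N) + \<kappa>)\<^sup>2 = A + B * t\<^sup>2 * (x\<^sup>2 + (2 * \<delta> / t) * x + (\<delta> / t)\<^sup>2)" for x
    using t by (simp add: \<delta>_def field_simps power2_eq_square)
  have "(\<Sum>x\<in>X. transition_weight X x * (A + B * (t * (x + 1 - N) + \<kappa>)\<^sup>2)) =
      A * (\<Sum>x\<in>X. transition_weight X x) +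
      B * t\<^sup>2 * (\<Sum>x\<in>X. transition_weight X x * (x\<^sup>2 + (2 * \<delta> / t) * x + (\<delta> / t)\<^sup>2))"
    unfolding eq by (simp only: sum_distrib_left sum.distrib[symmetric]) (simp add: algebra_simps)
  also have "\<dots> = A + B * t\<^sup>2 * (\<Sum>X + (\<delta> / t)\<^sup>2 + 2 * \<delta> / t * (N - 1) + (N - 1) * (N - 2) / 2)"
    by (simp only: transition_weight_sum[OF X] transition_weight_quadratic[OF X] N_def mult_1_right)
  also have "t\<^sup>2 * (\<Sum>X + (\<delta> / t)\<^sup>2 + 2 * \<delta> / t * (N - 1) + (N - 1) * (N - 2) / 2) =
      t\<^sup>2 * (\<Sum>X - N * (N - 1) / 2) + \<kappa>\<^sup>2"
    using t by (simp add: \<delta>_def field_simps power2_eq_square)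
  then have "A + B * t\<^sup>2 * (\<Sum>X + (\<delta> / t)\<^sup>2 + 2 * \<delta> / t * (N - 1) + (N - 1) * (N - 2) / 2) =
      A + B * (t\<^sup>2 * (\<Sum>X - N * (N - 1) / 2) + \<kappa>\<^sup>2)"
    by (simp only: mult.assoc)
  finally show ?thesis by (simp add: N_def)
qed

text \<open>Added hooks correspond to the beads whose site \<open>t\<close> higher is free; the
  chosen partition is unique by \<open>beads_inject\<close>. Zero weights then extend the sum to all
  beads, where it can be split by runners.\<close>

lemma sum_add_hook:
  fixes f :: "int \<Rightarrow> real"
  assumes t: "0 < t" and p: "is_partition \<mu>" and M: "sum_list \<mu> + t \<le> M"
  defines "X \<equiv> beads M \<mu>" and "S \<equiv> \<lambda>\<nu>. \<Sum>b\<in>young \<nu>. f (box_content b)"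
  shows "(\<Sum>\<nu>\<in>{\<nu>. add_hook t \<mu> \<nu>}. G_hook t \<nu> * (a + b * S \<nu>)) =
    G_hook t \<mu> * (\<Sum>x\<in>X. transition_weight (real ` runner t (x mod t) X) (real (x div t)) / t *
      (a + b * (S \<mu> + (\<Sum>y\<in>{x..<x + t}. f (int y + 1 - int M)))))"
proof -
  define A where "A = {x \<in> X. x + t \<notin> X}"
  define w where "w x = transition_weight (real ` runner t (x mod t) X) (real (x div t)) / t" for x
  define \<nu> where "\<nu> x = (SOME \<nu>. is_partition \<nu> \<and> length \<nu> \<le> M \<and> beads M \<nu> = insert (x + t) (X - {x}))" for x
  have lM: "length \<mu> \<le> M" using length_le_sum_list[OF p] M by simp
  have finX: "finite X" by (simp add: X_def)
  have \<nu>: "is_partition (\<nu> x)" "length (\<nu> x) \<le> M" "beads M (\<nu> x) = insert (x + t) (X - {x})" if "x \<in> A" for x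
  proof -
    have "X \<noteq> {}" using that by (auto simp: A_def)
    then have "card (insert (x + t) (X - {x})) = M"
      using that finX card_beads[OF p, of M] t M by (simp add: A_def X_def)
    then have "\<exists>\<nu>. is_partition \<nu> \<and> length \<nu> \<le> M \<and> beads M \<nu> = insert (x + t) (X - {x})"
      using finX by (intro ex_partition_beads) auto
    from someI_ex[OF this] show "is_partition (\<nu> x)" "length (\<nu> x) \<le> M" "beads M (\<nu> x) = insert (x + t) (X - {x})"
      by (simp_all add: \<nu>_def)
  qed
  have bij: "bij_betw \<nu> A {\<nu>. add_hook t \<mu> \<nu>}"
  proof (rule bij_betw_imageI)
    show "inj_on \<nu> A"
    proof (rule inj_onI)
      fix x y assume xy: "x \<in> A" "y \<in> A" "\<nu> x = \<nu> y"
      then have "insert (x + t) (X - {x}) = insert (y + t) (X - {y})" using \<nu>(3) by metis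
      then have "x + t \<in> insert (y + t) (X - {y})" by blast
      then show "x = y" using xy by (auto simp: A_def)
    qed
    show "\<nu> ` A = {\<nu>. add_hook t \<mu> \<nu>}"
    proof (intro equalityI subsetI)
      fix \<rho> assume "\<rho> \<in> \<nu> ` A"
      then obtain x where x: "x \<in> A" "\<rho> = \<nu> x" by blast
      then show "\<rho> \<in> {\<nu>. add_hook t \<mu> \<nu>}"
        using add_hookI_beads[OF p \<nu>(1)[OF x(1)] lM \<nu>(2)[OF x(1)], of x t] \<nu>(3)[OF x(1)]
        by (simp add: A_def X_def)
    next
      fix \<rho> assume "\<rho> \<in> {\<nu>. add_hook t \<mu> \<nu>}"
      then have \<rho>: "add_hook t \<mu> \<rho>" by simp
      have sM: "sum_list \<rho> \<le> M" using add_hook_size[OF \<rho>] M by simp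
      obtain x where x: "x \<in> X" "x + t \<notin> X" "beads M \<rho> = insert (x + t) (X - {x})"
        using add_hookE_beads[OF \<rho> sM] unfolding X_def by blast
      then have xA: "x \<in> A" by (simp add: A_def)
      have p\<rho>: "is_partition \<rho>" using \<rho> by (simp add: add_hook_def)
      have "\<rho> = \<nu> x"
      proof (rule beads_inject[OF p\<rho> \<nu>(1)[OF xA] _ \<nu>(2)[OF xA]])
        show "length \<rho> \<le> M" using length_le_sum_list[OF p\<rho>] sM by simp
      qed (simp add: x(3) \<nu>(3)[OF xA])
      with xA show "\<rho> \<in> \<nu> ` A" by blast
    qed
  qed
  have "(\<Sum>\<nu>\<in>{\<nu>. add_hook t \<mu> \<nu>}. G_hook t \<nu> * (a + b * S \<nu>)) =
      (\<Sum>x\<in>A. G_hook t (\<nu> x) * (a + b * S (\<nu> x)))"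
    by (rule sum.reindex_bij_betw[OF bij, symmetric])
  also have "\<dots> = (\<Sum>x\<in>A. G_hook t \<mu> * (w x * (a + b * (S \<mu> + (\<Sum>y\<in>{x..<x + t}. f (int y + 1 - int M))))))"
  proof (rule sum.cong[OF refl])
    fix x assume x: "x \<in> A"
    have xX: "x \<in> X" "x + t \<notin> X" using x by (auto simp: A_def)
    have "S (\<nu> x) = S \<mu> + (\<Sum>y\<in>{x..<x + t}. f (int y + 1 - int M))"
      using sum_contents_add_hook[OF p \<nu>(1)[OF x] lM \<nu>(2)[OF x], of x t f] xX \<nu>(3)[OF x]
      by (simp add: S_def X_def)
    moreover have "G_hook t (\<nu> x) = G_hook t \<mu> * w x"
    proof -
      have "w x = hook_prod t X / hook_prod t (insert (x + t) (X - {x}))"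
        using hook_prod_move[OF t finX xX] by (simp only: w_def)
      then show ?thesis
        using hook_prod_pos[OF finX, of t] G_hook_beads[OF \<nu>(1)[OF x] \<nu>(2)[OF x], of t]
        by (simp add: G_hook_beads[OF p lM] \<nu>(3)[OF x] X_def[symmetric])
    qed
    ultimately show "G_hook t (\<nu> x) * (a + b * S (\<nu> x)) =
        G_hook t \<mu> * (w x * (a + b * (S \<mu> + (\<Sum>y\<in>{x..<x + t}. f (int y + 1 - int M)))))" by simp
  qed
  also have "\<dots> = (\<Sum>x\<in>X. G_hook t \<mu> * (w x * (a + b * (S \<mu> + (\<Sum>y\<in>{x..<x + t}. f (int y + 1 - int M))))))"
  proof (rule sum.mono_neutral_left[OF finX])
    show "A \<subseteq> X" by (auto simp: A_def)
    have "w x = 0" if x: "x \<in> X - A" for x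
    proof -
      have "(x + t) div t \<in> runner t ((x + t) mod t) X"
        using x by (subst mem_runner_div_mod) (auto simp: A_def)
      then have "Suc (x div t) \<in> runner t (x mod t) X" using t by simp
      then have "real (x div t) + 1 \<in> real ` runner t (x mod t) X"
        by (intro image_eqI[of _ _ "Suc (x div t)"]) auto
      then show ?thesis
        unfolding w_def using finX t by (subst transition_weight_eq_0) (auto simp: finite_runner)
    qed
    then show "\<forall>x\<in>X - A. G_hook t \<mu> * (w x * (a + b * (S \<mu> + (\<Sum>y\<in>{x..<x + t}. f (int y + 1 - int M))))) = 0"
      by simp
  qed
  finally show ?thesis by (simp add: w_def sum_distrib_left)
qed

text \<open>Among \<open>t\<close> consecutive contents exactly one has residue \<open>k\<close>.
  Taking a multiple of \<open>t\<close> as the number of beads makes the shift invisible modulo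
  \<open>t\<close>.\<close>

lemma strip_content_square:
  assumes t: "0 < t" and k: "k < t" and r: "r < t"
  shows "(\<Sum>y\<in>{t * m + r..<t * m + r + t}.
      if [int y + 1 - int (t * L) = int k] (mod int t) then (real_of_int (int y + 1 - int (t * L)))\<^sup>2 else 0) =
    (real t * (real m + 1 - real L) + (if r < k then real k - real t else real k))\<^sup>2"
proof -
  \<comment> \<open>Site y carries the content y + 1 - t * L. The strip starts with y + 1 = t * m +
    r + 1, so residue k occurs at y + 1 = t * m + k if r < k, and one period later
    otherwise.\<close>
  define y where "y = (if r < k then t * m + k - 1 else t * m + t + k - 1)"
  have y1: "int y + 1 = int t * int m + (if r < k then int k else int t + int k)"
    using t by (auto simp: y_def of_nat_diff)
  have iff: "[int x + 1 - int (t * L) = int k] (mod int t) \<longleftrightarrow> x = y"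
    if x: "x \<in> {t * m + r..<t * m + r + t}" for x
  proof -
    have "[int x + 1 - int (t * L) = int k] (mod int t) \<longleftrightarrow> int t dvd int x + 1 - int (t * L) - int k"
      by (rule cong_iff_dvd_diff)
    also have "int x + 1 - int (t * L) - int k = (int x - int y) + int t * (int m - int L + (if r < k then 0 else 1))"
      using y1 by (simp add: algebra_simps)
    also have "int t dvd \<dots> \<longleftrightarrow> int t dvd int x - int y"
      by (simp add: dvd_add_left_iff)
    also have "\<dots> \<longleftrightarrow> x = y"
    proof
      assume d: "int t dvd int x - int y"
      have lt: "\<bar>int x - int y\<bar> < int t"
      proof -
        have "int (t * m + r) \<le> int x" "int x < int (t * m + r + t)"
          using x by (simp_all only: of_nat_le_iff of_nat_less_iff atLeastLessThan_iff)
        then have x': "int t * int m + int r \<le> int x" "int x < int t * int m + int r + int t"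
          by (simp_all only: of_nat_add of_nat_mult)
        have rk: "int r < int t" "int k < int t" using r k by simp_all
        show ?thesis
        proof (cases "r < k")
          case True
          then have "int y + 1 = int t * int m + int k" "int r < int k" using y1 by simp_all
          with x' rk show ?thesis by linarith
        next
          case False
          then have "int y + 1 = int t * int m + int t + int k" "int k \<le> int r" using y1 by simp_all
          with x' rk show ?thesis by linarith
        qed
      qed
      show "x = y"
      proof (rule ccontr)
        assume "x \<noteq> y"
        then have "int x - int y \<noteq> 0" by simp
        from dvd_imp_le_int[OF this d] lt show False by simp
      qed
    qed simp
    finally show ?thesis .
  qed
  have yin: "y \<in> {t * m + r..<t * m + r + t}" using r k by (auto simp: y_def)
  have "(\<Sum>x\<in>{t * m + r..<t * m + r + t}.
      if [int x + 1 - int (t * L) = int k] (mod int t) then (real_of_int (int x + 1 - int (t * L)))\<^sup>2 else 0) =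
    (\<Sum>x\<in>{t * m + r..<t * m + r + t}. if x = y then (real_of_int (int x + 1 - int (t * L)))\<^sup>2 else 0)"
    by (rule sum.cong) (simp_all only: iff)
  also have "\<dots> = (real_of_int (int y + 1 - int (t * L)))\<^sup>2"
    using yin by (simp only: sum.delta' finite_atLeastLessThan sum.delta if_True)
  also have "real_of_int (int y + 1 - int (t * L)) = real t * (real m + 1 - real L) + (if r < k then real k - real t else real k)"
    unfolding y1 by (simp add: algebra_simps)
  finally show ?thesis .
qed

section \<open>The one-step average for empty cores and the induction on n\<close>

lemma sum_nat_real: "(\<Sum>x<n. real x) = real n * (real n - 1) / 2"
  by (induction n) (auto simp: field_simps)

lemma sum_beads:
  assumes p: "is_partition \<mu>" and M: "length \<mu> \<le> M"
  shows "(\<Sum>x\<in>beads M \<mu>. real x) = real (sum_list \<mu>) + real M * (real M - 1) / 2"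
  using sum_contents_beads[OF p M, of "\<lambda>_. 1 :: real"] by (simp add: card_young sum_nat_real)

text \<open>The indicator inside the sum makes this an instance of the box sums in
  \<open>sum_add_hook\<close>.\<close>

definition content_sum :: "nat \<Rightarrow> nat \<Rightarrow> nat list \<Rightarrow> real" where
  "content_sum t k \<mu> = (\<Sum>b\<in>young \<mu>. if [box_content b = int k] (mod int t) then (real_of_int (box_content b))\<^sup>2 else 0)"

lemma sum_add_hook_content:
  assumes t: "0 < t" and k: "k < t" and \<mu>: "\<mu> \<in> empty_core_partitions t n"
  shows "(\<Sum>\<nu>\<in>{\<nu>. add_hook t \<mu> \<nu>}. G_hook t \<nu> * (a + b * content_sum t k \<nu>)) =
    G_hook t \<mu> * (a + b * (content_sum t k \<mu> + real t * real n + real k * (real t - real k)))"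
proof -
  define L where "L = Suc n"
  define M where "M = t * L"
  define X where "X = beads M \<mu>"
  define \<kappa> where "\<kappa> r = (if r < k then real k - real t else real k)" for r
  define A where "A = a + b * content_sum t k \<mu>"
  define R where "R r = real ` runner t r X" for r
  have p: "is_partition \<mu>" and ge: "hook_ge t \<mu> []" and size: "sum_list \<mu> = n * t"
    using \<mu> empty_core_partition[OF \<mu>] by (auto simp: empty_core_partitions_def)
  have M: "sum_list \<mu> + t \<le> M" by (simp add: size M_def L_def)
  have lM: "length \<mu> + t \<le> M" using length_le_sum_list[OF p] M by simp
  have finX: "finite X" by (simp add: X_def)
  have cardR: "card (R r) = L" and finR: "finite (R r)" and zR: "0 \<in> R r" and mR: "- 1 \<notin> R r"
    and sumR: "\<Sum>(R r) = (\<Sum>m\<in>runner t r X. real m)" if r: "r < t" for r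
  proof -
    have fin: "finite (runner t r X)" using finite_runner[OF t finX] .
    have "runner t r {..<M} = {..<L}"
    proof -
      have "t * m + r < t * L \<longleftrightarrow> m < L" for m
      proof
        assume "m < L"
        then have "t * Suc m \<le> t * L" by (intro mult_le_mono2) simp
        then show "t * m + r < t * L" using r by simp
      next
        assume "t * m + r < t * L"
        then have "t * m < t * L" by linarith
        then show "m < L" using nat_mult_less_cancel_disj by blast
      qed
      then show ?thesis by (auto simp: runner_def M_def)
    qed
    moreover have "card (runner t r X) = card (runner t r {..<M})"
      using hook_ge_card_runner[OF ge _ r, of M] M by (simp add: X_def)
    ultimately have "card (runner t r X) = L" by simp
    then show "card (R r) = L" by (simp add: R_def card_image)
    show "finite (R r)" using fin by (simp add: R_def)
    have "r \<in> X" unfolding X_def by (rule small_in_beads[OF lM r])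
    then have "0 \<in> runner t r X" by (simp add: runner_def)
    then show "0 \<in> R r" unfolding R_def by (metis image_eqI of_nat_0)
    show "- 1 \<notin> R r" by (auto simp: R_def)
    show "\<Sum>(R r) = (\<Sum>m\<in>runner t r X. real m)" by (simp add: R_def sum.reindex)
  qed
  define \<Sigma> where "\<Sigma> = (\<Sum>r<t. \<Sum>(R r))"
  have "(\<Sum>x\<in>X. transition_weight (real ` runner t (x mod t) X) (real (x div t)) / t *
      (a + b * (content_sum t k \<mu> + (\<Sum>y\<in>{x..<x + t}.
        if [int y + 1 - int M = int k] (mod int t) then (real_of_int (int y + 1 - int M))\<^sup>2 else 0)))) =
    (\<Sum>r<t. \<Sum>m\<in>runner t r X. transition_weight (R r) (real m) / t *
      (A + b * (real t * (real m + 1 - real L) + \<kappa> r)\<^sup>2))"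
    unfolding sum_runners[OF t finX]
  proof (intro sum.cong refl)
    fix r m assume "r \<in> {..<t}"
    then have r: "r < t" by simp
    then have "(t * m + r) mod t = r" "(t * m + r) div t = m" using t by simp_all
    then show "transition_weight (real ` runner t ((t * m + r) mod t) X) (real ((t * m + r) div t)) / t *
        (a + b * (content_sum t k \<mu> + (\<Sum>y\<in>{t * m + r..<t * m + r + t}.
          if [int y + 1 - int M = int k] (mod int t) then (real_of_int (int y + 1 - int M))\<^sup>2 else 0))) =
      transition_weight (R r) (real m) / t * (A + b * (real t * (real m + 1 - real L) + \<kappa> r)\<^sup>2)"
      unfolding M_def strip_content_square[OF t k r] by (simp add: R_def A_def \<kappa>_def algebra_simps)
  qed
  also have "\<dots> = (\<Sum>r<t. (\<Sum>x\<in>R r. transition_weight (R r) x *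
      (A + b * (real t * (x + 1 - real (card (R r))) + \<kappa> r)\<^sup>2)) / t)"
    by (rule sum.cong[OF refl]) (simp add: cardR, simp add: R_def sum.reindex sum_divide_distrib)
  also have "\<dots> = (\<Sum>r<t. (A + b * ((real t)\<^sup>2 * (\<Sum>(R r) - real L * (real L - 1) / 2) + (\<kappa> r)\<^sup>2)) / t)"
    using t by (intro sum.cong refl) (simp add: transition_weight_square finR zR mR, simp add: cardR)
  also have "\<dots> = (real t * A + b * ((real t)\<^sup>2 * (\<Sigma> - real t * (real L * (real L - 1) / 2)) + (\<Sum>r<t. (\<kappa> r)\<^sup>2))) / t"
    by (simp add: \<Sigma>_def sum.distrib sum_subtractf flip: sum_divide_distrib sum_distrib_left)
  \<comment> \<open>This value is t * k * (t - k); the division by t leaves the constant of the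
    theorem.\<close>
  also have "(\<Sum>r<t. (\<kappa> r)\<^sup>2) = real k * (real k - real t)\<^sup>2 + (real t - real k) * (real k)\<^sup>2"
  proof -
    have "(\<Sum>r<t. (\<kappa> r)\<^sup>2) = (\<Sum>r\<in>{..<k} \<union> {k..<t}. (\<kappa> r)\<^sup>2)"
      using k by (intro sum.cong) auto
    also have "\<dots> = (\<Sum>r<k. (real k - real t)\<^sup>2) + (\<Sum>r\<in>{k..<t}. (real k)\<^sup>2)"
      by (subst sum.union_disjoint) (auto simp: \<kappa>_def)
    finally show ?thesis using k by (simp add: of_nat_diff)
  qed
  also have "(real t * A + b * ((real t)\<^sup>2 * (\<Sigma> - real t * (real L * (real L - 1) / 2)) +
      (real k * (real k - real t)\<^sup>2 + (real t - real k) * (real k)\<^sup>2))) / t =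
    A + b * (real t * real n + real k * (real t - real k))"
  proof -
    \<comment> \<open>Adding up the beads directly and along the runners gives \<Sigma> = n + t * L
      * (L - 1) / 2: the partitions on the runners have total size n.\<close>
    have "(\<Sum>x\<in>X. real x) = (\<Sum>r<t. \<Sum>m\<in>runner t r X. real t * real m + real r)"
      by (simp add: sum_runners[OF t finX])
    also have "\<dots> = (\<Sum>r<t. real t * \<Sum>(R r) + real L * real r)"
    proof (rule sum.cong[OF refl])
      fix r assume "r \<in> {..<t}"
      then have r: "r < t" by simp
      have "card (runner t r X) = L" using cardR[OF r] by (simp add: R_def card_image)
      then show "(\<Sum>m\<in>runner t r X. real t * real m + real r) = real t * \<Sum>(R r) + real L * real r"
        by (simp add: sumR[OF r] sum.distrib sum_distrib_left)
    qed
    also have "\<dots> = real t * \<Sigma> + real L * (real t * (real t - 1) / 2)"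
      by (simp add: \<Sigma>_def sum.distrib flip: sum_distrib_left sum_nat_real)
    finally have "real t * \<Sigma> = real n * real t + real M * (real M - 1) / 2 - real L * (real t * (real t - 1) / 2)"
      using sum_beads[OF p, of M] lM by (simp add: X_def size)
    then have "real t * \<Sigma> = real t * (real n + real L * (real t * real L - 1) / 2 - real L * (real t - 1) / 2)"
      by (simp add: M_def field_simps)
    moreover have "real t \<noteq> 0" using t by simp
    ultimately have \<Sigma>: "\<Sigma> = real n + real L * (real t * real L - 1) / 2 - real L * (real t - 1) / 2"
      by (metis mult_left_cancel)
    show ?thesis using t unfolding \<Sigma> by (simp add: field_simps power2_eq_square)
  qed
  finally show ?thesis
    unfolding sum_add_hook[OF t p M, of a b "\<lambda>c. if [c = int k] (mod int t) then (real_of_int c)\<^sup>2 else 0",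
      folded content_sum_def X_def]
    by (simp only: A_def) (simp add: algebra_simps)
qed

lemma G_hook_Nil [simp]: "G_hook t [] = 1"
  by (simp add: G_hook_def hook_lengths_def young_def)

lemma F_skew_refl [simp]: "F_skew t \<mu> \<mu> = 1"
  by (subst F_skew.simps) simp

text \<open>One step turns the constant \<open>a\<close> into a + b * (t * n + k * (t - k)), so the
  induction needs every \<open>a\<close>; the affine form carries the total mass and the content sum
  together.\<close>

lemma sum_F_G_content:
  assumes t: "0 < t" and k: "k < t"
  shows "(\<Sum>\<mu>\<in>empty_core_partitions t n. real (F_skew t \<mu> []) * (G_hook t \<mu> * (a + b * content_sum t k \<mu>))) =
    a + b * (real t * real (n choose 2) + real k * (real t - real k) * real n)"
proof (induction n arbitrary: a)
  case 0
  then show ?case by (simp add: empty_core_partitions_0 content_sum_def young_def)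
next
  case (Suc n)
  define c where "c = real t * real n + real k * (real t - real k)"
  have "(\<Sum>\<mu>\<in>empty_core_partitions t (Suc n). real (F_skew t \<mu> []) * (G_hook t \<mu> * (a + b * content_sum t k \<mu>))) =
      (\<Sum>\<mu>\<in>empty_core_partitions t n. real (F_skew t \<mu> []) * (G_hook t \<mu> * ((a + b * c) + b * content_sum t k \<mu>)))"
    unfolding sum_F_skew_Suc[OF t]
  proof (intro sum.cong refl)
    fix \<mu> assume "\<mu> \<in> empty_core_partitions t n"
    from sum_add_hook_content[OF t k this, of a b]
    show "real (F_skew t \<mu> []) * (\<Sum>\<nu>\<in>{\<nu>. add_hook t \<mu> \<nu>}. G_hook t \<nu> * (a + b * content_sum t k \<nu>)) =
        real (F_skew t \<mu> []) * (G_hook t \<mu> * ((a + b * c) + b * content_sum t k \<mu>))"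
      by (simp only:) (simp add: c_def algebra_simps)
  qed
  also have "\<dots> = (a + b * c) + b * (real t * real (n choose 2) + real k * (real t - real k) * real n)"
    by (rule Suc.IH)
  also have "\<dots> = a + b * (real t * real (Suc n choose 2) + real k * (real t - real k) * real (Suc n))"
    by (simp add: c_def numeral_2_eq_2 algebra_simps)
  finally show ?case .
qed

theorem theorem1p9:
  fixes t k n :: nat
  assumes "0 < t" and "k \<le> t - 1"
  shows "(\<Sum>\<mu> \<in> {\<mu>. is_partition \<mu> \<and> t_core t \<mu> = [] \<and> sum_list \<mu> = n * t}.
            real (F_hook t \<mu>) * G_hook t \<mu> *
            (\<Sum>b \<in> {b \<in> young \<mu>. [box_content b = int k] (mod int t)}. (real_of_int (box_content b))\<^sup>2))
         = real t * real (n choose 2) + real k * (real t - real k) * real n"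
proof -
  have k: "k < t" using assms by simp
  have "(\<Sum>\<mu> \<in> empty_core_partitions t n. real (F_hook t \<mu>) * G_hook t \<mu> *
      (\<Sum>b \<in> {b \<in> young \<mu>. [box_content b = int k] (mod int t)}. (real_of_int (box_content b))\<^sup>2)) =
    (\<Sum>\<mu>\<in>empty_core_partitions t n. real (F_skew t \<mu> []) * (G_hook t \<mu> * (0 + 1 * content_sum t k \<mu>)))"
  proof (rule sum.cong[OF refl])
    fix \<mu> assume "\<mu> \<in> empty_core_partitions t n"
    then have "t_core t \<mu> = []" using empty_core_partitions_eq[OF assms(1), of n] by blast
    moreover have "(\<Sum>b \<in> {b \<in> young \<mu>. [box_content b = int k] (mod int t)}. (real_of_int (box_content b))\<^sup>2) =
        content_sum t k \<mu>"
      unfolding content_sum_def by (rule sum.inter_filter) simp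
    ultimately show "real (F_hook t \<mu>) * G_hook t \<mu> *
        (\<Sum>b \<in> {b \<in> young \<mu>. [box_content b = int k] (mod int t)}. (real_of_int (box_content b))\<^sup>2) =
      real (F_skew t \<mu> []) * (G_hook t \<mu> * (0 + 1 * content_sum t k \<mu>))"
      by (simp add: F_hook_def)
  qed
  also have "\<dots> = 0 + 1 * (real t * real (n choose 2) + real k * (real t - real k) * real n)"
    by (rule sum_F_G_content[OF assms(1) k])
  finally show ?thesis unfolding empty_core_partitions_eq[OF assms(1)] by simp
qed

end
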